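(* Let $H$ be a finitely generated subgroup of Thompson's group $F$. Then the closure $Cl(H)$ of $H$ is finitely generated and has linear distortion in $F$.
   Context: $F$ is the group of all piecewise-linear homeomorphisms of $[0,1]$ with finitely many breakpoints, all of them in $\mathbb Z[\frac12]\cap(0,1)$, and all slopes integer powers of $2$. For a subgroup $H\le F$, the closure $Cl(H)$ is the subgroup of $F$ of all piecewise-$H$ functions: all $f\in F$ for which there are dyadic numbers $0=a_0<a_1<\dots<a_k=1$ and $h_1,\dots,h_k\in H$ such that $f$ coincides with $h_i$ on $[a_{i-1},a_i]$ for each $i$. If $G$ is a group generated by a finite set $S$ and $K\le G$ is a subgroup generated by a finite set $T$, the distortion function $\delta_{S,T}\colon\mathbb N\to\mathbb N$ is the smallest function such that every element of $K$ which is a product of $n$ elements of $S$ (and their inverses) is a product of at most $\delta_{S,T}(n)$ elements of $T$ (and their inverses). Two functions $f,g\colon\mathbb N\to\mathbb N$ are equivalent if for some $c>1$, $\frac1c f(\frac nc)-c\le g(n)\le cf(cn)+c$ for all $n$; up to equivalence $\delta_{S,T}$ does not depend on $S,T$. $K$ has linear distortion in $G$ (is undistorted in $G$) if the distortion function is linear, i.e. the word length on $K$ with respect to $T$ is bounded from above by a linear function of the word length with respect to $S$. *)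

theory Defs
  imports "HOL-Analysis.Analysis" "HOL-Algebra.Bij" "HOL-Algebra.Generated_Groups"
begin

subsection \<open>Thompson's group and closures of its subgroups\<close>

definition dyadic :: "real set" where
  "dyadic = {of_int p / 2 ^ n | (p :: int) (n :: nat). True}"

definition dyadic_partition :: "nat \<Rightarrow> (nat \<Rightarrow> real) \<Rightarrow> bool" where
  "dyadic_partition k a \<longleftrightarrow>
     a 0 = 0 \<and> a k = 1 \<and> (\<forall>i<k. a i < a (Suc i)) \<and> (\<forall>i\<le>k. a i \<in> dyadic)"

text \<open>
  All breakpoints lie in a finite set of dyadic numbers of the open unit interval iff the function
  is affine on every piece of some dyadic partition. A homeomorphism of the unit interval is
  represented by its extension with value \<open>undefined\<close> outside the interval, as in
  \<^const>\<open>BijGroup\<close>, so that equality of functions is equality on the interval.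
\<close>

definition thompson_carrier :: "(real \<Rightarrow> real) set" where
  "thompson_carrier =
     {f \<in> Bij {0..1}.
        (\<exists>g. homeomorphism {0..1} {0..1} f g) \<and>
        (\<exists>k a. dyadic_partition k a \<and>
           (\<forall>i<k. \<exists>(m :: int) c. \<forall>x\<in>{a i..a (Suc i)}. f x = 2 powi m * x + c))}"

definition thompson_F :: "(real \<Rightarrow> real) monoid" where
  "thompson_F = BijGroup {0..1} \<lparr>carrier := thompson_carrier\<rparr>"

definition Cl :: "(real \<Rightarrow> real) set \<Rightarrow> (real \<Rightarrow> real) set" where
  "Cl H =
     {f \<in> carrier thompson_F.
        \<exists>k a h. dyadic_partition k a \<and>
          (\<forall>i<k. h i \<in> H \<and> (\<forall>x\<in>{a i..a (Suc i)}. f x = h i x))}"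

subsection \<open>Finite generation and distortion\<close>

definition finite_generating_set :: "('a, 'b) monoid_scheme \<Rightarrow> 'a set \<Rightarrow> 'a set \<Rightarrow> bool" where
  "finite_generating_set G K T \<longleftrightarrow> finite T \<and> T \<subseteq> carrier G \<and> generate G T = K"

definition finitely_generated :: "('a, 'b) monoid_scheme \<Rightarrow> 'a set \<Rightarrow> bool" where
  "finitely_generated G K \<longleftrightarrow> (\<exists>T. finite_generating_set G K T)"

definition word_products :: "('a, 'b) monoid_scheme \<Rightarrow> 'a set \<Rightarrow> nat \<Rightarrow> 'a set" where
  "word_products G S n =
     {foldr (mult G) w \<one>\<^bsub>G\<^esub> | w. length w = n \<and> set w \<subseteq> S \<union> m_inv G ` S}"

text \<open>
  When \<open>S\<close> and \<open>T\<close> are finite and \<open>T\<close> generates \<open>K\<close>, only finitely many elements of \<open>K\<close> are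
  products of \<open>n\<close> letters of \<open>S\<close>, so the least bound below exists.
\<close>

definition distortion ::
    "('a, 'b) monoid_scheme \<Rightarrow> 'a set \<Rightarrow> 'a set \<Rightarrow> 'a set \<Rightarrow> nat \<Rightarrow> nat" where
  "distortion G K S T n =
     (LEAST m. K \<inter> word_products G S n \<subseteq> (\<Union>j\<le>m. word_products G T j))"

text \<open>
  Distortion is defined only for a finitely generated subgroup of a finitely generated group, so
  both are required, which keeps the quantification over generating sets from being vacuous.
  Linear means bounded above by a linear function. A constant term is not needed, because the
  distortion function vanishes at \<open>0\<close>. There is no lower bound, so that finite subgroups qualify.
\<close>

definition linear_distortion :: "('a, 'b) monoid_scheme \<Rightarrow> 'a set \<Rightarrow> bool" where
  "linear_distortion G K \<longleftrightarrow>
     finitely_generated G (carrier G) \<and> finitely_generated G K \<and>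
     (\<forall>S T. finite_generating_set G (carrier G) S \<longrightarrow> finite_generating_set G K T \<longrightarrow>
        (\<exists>C. \<forall>n. distortion G K S T n \<le> C * n))"

end

theory Submission
  imports Defs
begin

text \<open>
  Let \<open>K = Cl H\<close> and call two standard dyadic intervals equivalent if some element of \<open>K\<close> maps one
  affinely onto the other. An interval is free if every element of \<open>K\<close> maps it affinely onto a
  standard dyadic interval. The intervals that are not free fall into finitely many classes: an
  element of \<open>H\<close> that fails on \<open>u\<close>, written as a word in the generators, first fails at a letter \<open>s\<close>,
  so \<open>u\<close> is equivalent to one of the finitely many intervals on which \<open>s\<close> fails.

  An \<open>f \<in> K\<close> is given by two trees \<open>T, T'\<close> of standard dyadic intervals whose leaves have the same
  sequence of classes and whose inner nodes are not free. The number of inner nodes is subadditive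
  in \<open>f\<close>, hence linear in the word length of \<open>f\<close> in \<open>F\<close>. Reading a tree depth first, with a pointer
  moving through the subdivision, one writes the tree as a product of boundedly many letters of \<open>K\<close>
  per node: one letter for expanding the class at the pointer and one for moving the pointer across
  a class. The pointer is kept at the representative of the \<open>K\<close>-orbit of the dyadic point it marks,
  so that a letter depends only on the class, and being piecewise in \<open>K\<close>, it lies in \<open>K\<close>. The product
  depends only on the classes of the leaves, up to the map carrying one leaf sequence to the other,
  so the products of \<open>T\<close> and \<open>T'\<close> differ by \<open>f\<close>. The same argument applies to \<open>K = F\<close>.
\<close>

subsection \<open>Standard dyadic intervals\<close>

type_synonym ivl = "real \<times> real"

definition dint :: "nat \<Rightarrow> ivl set" where
  "dint n = {u. 0 \<le> fst u \<and> snd u \<le> 1 \<and> snd u = fst u + 1 / 2 ^ n \<and> fst u * 2 ^ n \<in> \<int>}"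

definition std :: "ivl set" where
  "std = (\<Union>n. dint n)"

definition mid :: "ivl \<Rightarrow> real" where
  "mid u = (fst u + snd u) / 2"

definition lc :: "ivl \<Rightarrow> ivl" where
  "lc u = (fst u, mid u)"

definition rc :: "ivl \<Rightarrow> ivl" where
  "rc u = (mid u, snd u)"

definition lin :: "ivl \<Rightarrow> ivl \<Rightarrow> real \<Rightarrow> real" where
  "lin u v t = fst v + (snd v - fst v) * ((t - fst u) / (snd u - fst u))"

definition img :: "(real \<Rightarrow> real) \<Rightarrow> ivl \<Rightarrow> ivl" where
  "img f u = (f (fst u), f (snd u))"

definition good :: "(real \<Rightarrow> real) \<Rightarrow> ivl \<Rightarrow> bool" where
  "good f u \<longleftrightarrow> img f u \<in> std \<and> (\<forall>t\<in>{fst u..snd u}. f t = lin u (img f u) t)"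

definition deep :: "(ivl \<Rightarrow> bool) \<Rightarrow> bool" where
  "deep Q \<longleftrightarrow> (\<forall>\<^sub>F n in sequentially. \<forall>u\<in>dint n. Q u)"

lemma fst_lc [simp]: "fst (lc u) = fst u" and snd_lc [simp]: "snd (lc u) = mid u"
  and fst_rc [simp]: "fst (rc u) = mid u" and snd_rc [simp]: "snd (rc u) = snd u"
  by (simp_all add: lc_def rc_def)

lemma fst_img [simp]: "fst (img f u) = f (fst u)" and snd_img [simp]: "snd (img f u) = f (snd u)"
  by (simp_all add: img_def)

lemma dint_0 [simp]: "dint 0 = {(0, 1)}"
  by (auto simp: dint_def)

lemma dint_mid:
  assumes "u \<in> dint n"
  shows "mid u = fst u + 1 / 2 ^ Suc n" "snd u = mid u + 1 / 2 ^ Suc n"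
  using assms by (simp_all add: dint_def mid_def add_divide_distrib)

lemma dint_bounds:
  assumes "u \<in> dint n"
  shows "0 \<le> fst u" "fst u < mid u" "mid u < snd u" "snd u \<le> 1" "fst u < snd u"
proof -
  show "0 \<le> fst u" "snd u \<le> 1" using assms by (auto simp: dint_def)
  have "0 < (1 / 2 ^ Suc n :: real)" by simp
  then show "fst u < mid u" "mid u < snd u" "fst u < snd u" using dint_mid[OF assms] by linarith+
qed

lemma std_bounds:
  assumes "u \<in> std"
  shows "0 \<le> fst u" "fst u < mid u" "mid u < snd u" "snd u \<le> 1" "fst u < snd u"
  using assms dint_bounds unfolding std_def by blast+

lemma lc_dint:
  assumes "u \<in> dint n" shows "lc u \<in> dint (Suc n)"
proof -
  have z: "fst u * 2 ^ n \<in> \<int>" using assms by (auto simp: dint_def)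
  have "fst u * 2 ^ Suc n = 2 * (fst u * 2 ^ n)" by simp
  also have "\<dots> \<in> \<int>" using z by (rule Ints_mult[OF Ints_numeral])
  finally have "fst u * 2 ^ Suc n \<in> \<int>" .
  moreover have "mid u \<le> 1" using dint_bounds[OF assms] by linarith
  ultimately show ?thesis using dint_mid(1)[OF assms] dint_bounds(1)[OF assms]
    unfolding dint_def by (simp del: power_Suc)
qed

lemma rc_dint:
  assumes "u \<in> dint n" shows "rc u \<in> dint (Suc n)"
proof -
  have z: "fst u * 2 ^ n \<in> \<int>" using assms by (auto simp: dint_def)
  have "mid u * 2 ^ Suc n = 2 * (fst u * 2 ^ n) + 1"
    unfolding dint_mid(1)[OF assms] by (simp add: field_simps)
  also have "\<dots> \<in> \<int>" by (rule Ints_add[OF Ints_mult[OF Ints_numeral z] Ints_1])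
  finally show ?thesis using dint_mid[OF assms] dint_bounds[OF assms]
    unfolding dint_def by (simp del: power_Suc)
qed

lemma dint_parent:
  assumes "v \<in> dint (Suc n)"
  obtains u where "u \<in> dint n" "v = lc u \<or> v = rc u"
proof -
  obtain z where z: "fst v * 2 ^ Suc n = of_int z" using assms by (auto simp: dint_def elim: Ints_cases)
  have a: "fst v = of_int z / 2 ^ Suc n" using z by (simp add: field_simps)
  have b: "snd v = (of_int z + 1) / 2 ^ Suc n" using assms a by (auto simp: dint_def field_simps)
  have "0 \<le> fst v" "snd v \<le> 1" using assms by (auto simp: dint_def)
  then have "0 \<le> (of_int z :: real)" "of_int z + 1 \<le> (2::real) ^ Suc n"
    unfolding a b by (simp_all add: field_simps)
  then have "(of_int 0 :: real) \<le> of_int z" "(of_int (z + 1) :: real) \<le> of_int (2 ^ Suc n)" by simp_all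
  then have z0: "0 \<le> z" and z1: "z + 1 \<le> 2 ^ Suc n"
    unfolding of_int_le_iff by blast+
  show thesis
  proof (cases "even z")
    case True
    then obtain w where w: "z = 2 * w" by auto
    then have "w + 1 \<le> 2 ^ n" "0 \<le> w" using z1 z0 by auto
    then have "(of_int (w + 1) :: real) \<le> of_int (2 ^ n)" "(of_int 0 :: real) \<le> of_int w"
      unfolding of_int_le_iff by blast+
    then have "of_int w + 1 \<le> (2::real) ^ n" "0 \<le> (of_int w :: real)" by simp_all
    then show ?thesis using a b w
      by (intro that[of "(of_int w / 2 ^ n, (of_int w + 1) / 2 ^ n)"])
        (auto simp: dint_def lc_def mid_def prod_eq_iff field_simps)
  next
    case False
    then obtain w where w: "z = 2 * w + 1" by (auto elim: oddE)
    then have "w + 1 \<le> 2 ^ n" "0 \<le> w" using z1 z0 by auto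
    then have "(of_int (w + 1) :: real) \<le> of_int (2 ^ n)" "(of_int 0 :: real) \<le> of_int w"
      unfolding of_int_le_iff by blast+
    then have "of_int w + 1 \<le> (2::real) ^ n" "0 \<le> (of_int w :: real)" by simp_all
    then show ?thesis using a b w
      by (intro that[of "(of_int w / 2 ^ n, (of_int w + 1) / 2 ^ n)"])
        (auto simp: dint_def rc_def mid_def prod_eq_iff field_simps)
  qed
qed

lemma dint_Suc: "dint (Suc n) = lc ` dint n \<union> rc ` dint n"
proof
  show "dint (Suc n) \<subseteq> lc ` dint n \<union> rc ` dint n" using dint_parent by blast
  show "lc ` dint n \<union> rc ` dint n \<subseteq> dint (Suc n)" using lc_dint rc_dint by blast
qed

lemma finite_dint [simp]: "finite (dint n)"
  by (induction n) (auto simp: dint_Suc)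

lemma std_lc: "u \<in> std \<Longrightarrow> lc u \<in> std" and std_rc: "u \<in> std \<Longrightarrow> rc u \<in> std"
  using lc_dint rc_dint unfolding std_def by blast+

lemma unit_std [simp]: "(0, 1) \<in> std"
  using dint_0 unfolding std_def by blast

lemma dint_std: "u \<in> dint n \<Longrightarrow> u \<in> std"
  unfolding std_def by blast

lemma level_induct:
  assumes base: "\<And>u. u \<in> dint n \<Longrightarrow> P u"
    and step: "\<And>u. u \<in> std \<Longrightarrow> P (lc u) \<Longrightarrow> P (rc u) \<Longrightarrow> P u"
  shows "P (0, 1)"
proof -
  have "\<forall>u\<in>dint n. P u \<Longrightarrow> P (0, 1)" for n
  proof (induction n)
    case (Suc n)
    then show ?case using step dint_std lc_dint rc_dint by blast
  qed simp
  then show ?thesis using base by blast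
qed

lemma lin_fst [simp]: "lin u v (fst u) = fst v"
  by (simp add: lin_def)

lemma lin_snd [simp]: "fst u < snd u \<Longrightarrow> lin u v (snd u) = snd v"
  by (simp add: lin_def)

lemma lin_mono: "fst u < snd u \<Longrightarrow> fst v < snd v \<Longrightarrow> s < t \<Longrightarrow> lin u v s < lin u v t"
  by (simp add: lin_def divide_strict_right_mono)

lemma lin_mono_le: "fst u < snd u \<Longrightarrow> fst v < snd v \<Longrightarrow> s \<le> t \<Longrightarrow> lin u v s \<le> lin u v t"
  using lin_mono[of u v s t] by (cases "s = t") auto

lemma lin_range:
  assumes "fst u < snd u" "fst v < snd v" "t \<in> {fst u..snd u}"
  shows "lin u v t \<in> {fst v..snd v}"
  using lin_mono_le[of u v "fst u" t] lin_mono_le[of u v t "snd u"] assms by auto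

lemma lin_lin: "fst u < snd u \<Longrightarrow> fst v < snd v \<Longrightarrow> lin v w (lin u v t) = lin u w t"
  by (simp add: lin_def)

lemma lin_self: "fst u < snd u \<Longrightarrow> lin u u t = t"
  by (simp add: lin_def)

lemma lin_mid: "fst u < snd u \<Longrightarrow> lin u v (mid u) = mid v"
  by (simp add: lin_def mid_def field_simps)

lemma lin_lc: "fst u < snd u \<Longrightarrow> lin (lc u) (lc v) t = lin u v t"
  by (simp add: lin_def mid_def field_simps)

lemma lin_rc:
  assumes "fst u < snd u" shows "lin (rc u) (rc v) t = lin u v t"
proof -
  obtain a b c d where [simp]: "u = (a, b)" "v = (c, d)" by (cases u, cases v) auto
  have "b - a \<noteq> 0" "b - (a + b) / 2 = (b - a) / 2" "d - (c+d)/2 = (d-c)/2" using assms by (auto simp: field_simps)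
  then show ?thesis unfolding lin_def by (simp add: mid_def) (simp add: field_simps)
qed

lemma goodD:
  assumes "good f u" "t \<in> {fst u..snd u}"
  shows "f t = lin u (img f u) t"
  using assms by (simp add: good_def)

lemma img_std: "good f u \<Longrightarrow> img f u \<in> std"
  by (simp add: good_def)

lemma good_mid:
  assumes "u \<in> std" "good f u"
  shows "f (mid u) = mid (img f u)"
  using std_bounds[OF assms(1)] by (subst goodD[OF assms(2)]) (auto simp: lin_mid)

lemma img_lc: "u \<in> std \<Longrightarrow> good f u \<Longrightarrow> img f (lc u) = lc (img f u)"
  and img_rc: "u \<in> std \<Longrightarrow> good f u \<Longrightarrow> img f (rc u) = rc (img f u)"
  by (simp_all add: img_def lc_def rc_def good_mid prod_eq_iff)

lemma good_lc: assumes "u \<in> std" "good f u" shows "good f (lc u)"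
  unfolding good_def img_lc[OF assms]
  using assms std_bounds[OF assms(1)] by (auto simp: std_lc img_std lin_lc goodD)

lemma good_rc: assumes "u \<in> std" "good f u" shows "good f (rc u)"
  unfolding good_def img_rc[OF assms]
  using assms std_bounds[OF assms(1)] by (auto simp: std_rc img_std lin_rc goodD)

lemma good_deeper:
  assumes "\<forall>u\<in>dint n. good f u" "u \<in> dint (n + k)"
  shows "good f u \<and> (\<exists>m\<ge>k. img f u \<in> dint m)"
  using assms(2)
proof (induction k arbitrary: u)
  case 0
  then show ?case using assms(1) img_std unfolding std_def by fastforce
next
  case (Suc k)
  then obtain v where v: "v \<in> dint (n + k)" "u = lc v \<or> u = rc v"
    using dint_parent unfolding add_Suc_right by blast
  then obtain m where m: "good f v" "m \<ge> k" "img f v \<in> dint m" using Suc.IH by blast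
  have s: "v \<in> std" using v dint_std by blast
  have "img f u \<in> dint (Suc m)"
    using v m s by (auto simp: img_lc img_rc lc_dint rc_dint)
  then show ?case using v m s good_lc good_rc by (meson Suc_le_mono)
qed

lemma deep_img:
  assumes "deep (good f)" "deep Q"
  shows "deep (\<lambda>u. Q (img f u))"
proof -
  obtain n where n: "\<forall>u\<in>dint n. good f u" using assms(1)
    unfolding deep_def eventually_sequentially by blast
  obtain m where m: "\<And>k u. k \<ge> m \<Longrightarrow> u \<in> dint k \<Longrightarrow> Q u" using assms(2)
    unfolding deep_def eventually_sequentially by blast
  have "Q (img f u)" if "k \<ge> n + m" "u \<in> dint k" for k u
  proof -
    have "u \<in> dint (n + (k - n))" using that by simp
    then obtain j where "j \<ge> k - n" "img f u \<in> dint j" using good_deeper[OF n] by blast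
    then show ?thesis using m[of j] that by simp
  qed
  then show ?thesis unfolding deep_def eventually_sequentially by blast
qed

lemma deep_level: "deep Q \<Longrightarrow> \<exists>n. \<forall>u\<in>dint n. Q u"
  unfolding deep_def eventually_sequentially by blast

lemma deep_mono2:
  "deep P \<Longrightarrow> deep Q \<Longrightarrow> (\<And>u. u \<in> std \<Longrightarrow> P u \<Longrightarrow> Q u \<Longrightarrow> R u) \<Longrightarrow> deep R"
  unfolding deep_def by (erule (1) eventually_elim2) (blast intro: dint_std)

lemma good_level_mono_surj:
  assumes "\<forall>u\<in>dint n. good f u"
  shows "strict_mono_on {0..1} f \<and> f ` {0..1} = {f 0..f 1} \<and> continuous_on {0..1} f"
proof -
  let ?P = "\<lambda>u. strict_mono_on {fst u..snd u} f \<and> f ` {fst u..snd u} = {f (fst u)..f (snd u)}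
     \<and> continuous_on {fst u..snd u} f"
  have "?P (0, 1)"
  proof (rule level_induct[where n=n])
    fix u assume u: "u \<in> dint n"
    then have g: "good f u" "u \<in> std" using assms dint_std by auto
    have b: "fst u < snd u" "f (fst u) < f (snd u)"
      using std_bounds[OF g(2)] std_bounds[OF img_std[OF g(1)]] by auto
    let ?v = "img f u"
    have eq: "\<And>t. t \<in> {fst u..snd u} \<Longrightarrow> f t = lin u ?v t" using g goodD by blast
    have "strict_mono_on {fst u..snd u} f"
      using b by (intro strict_mono_onI) (metis eq lin_mono fst_img snd_img)
    moreover have "continuous_on {fst u..snd u} f"
    proof -
      have "continuous_on {fst u..snd u} (lin u ?v)"
        using b unfolding lin_def by (intro continuous_intros) auto
      then show ?thesis using eq by (subst continuous_on_cong[OF refl, of _ f "lin u ?v"]) auto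
    qed
    moreover have "f ` {fst u..snd u} = {f (fst u)..f (snd u)}"
    proof
      show "f ` {fst u..snd u} \<subseteq> {f (fst u)..f (snd u)}"
      proof
        fix s assume "s \<in> f ` {fst u..snd u}"
        then obtain t where t: "t \<in> {fst u..snd u}" "s = lin u ?v t" using eq by blast
        have "lin u ?v t \<in> {fst ?v..snd ?v}" using b t(1) by (intro lin_range) auto
        then show "s \<in> {f (fst u)..f (snd u)}" using t(2) by (simp del: atLeastAtMost_iff)
      qed
      show "{f (fst u)..f (snd u)} \<subseteq> f ` {fst u..snd u}"
      proof
        fix s assume s: "s \<in> {f (fst u)..f (snd u)}"
        then have "lin ?v u s \<in> {fst u..snd u}" using b lin_range[of ?v u s] by simp
        moreover from this have "f (lin ?v u s) = lin u ?v (lin ?v u s)" by (rule eq)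
        moreover have "lin u ?v (lin ?v u s) = s" using b by (simp add: lin_lin lin_self)
        ultimately show "s \<in> f ` {fst u..snd u}" by (metis imageI)
      qed
    qed
    ultimately show "?P u" by blast
  next
    fix u assume u: "u \<in> std" and l: "?P (lc u)" and r: "?P (rc u)"
    have b: "fst u < mid u" "mid u < snd u" using std_bounds[OF u] by auto
    have un: "{fst u..snd u} = {fst u..mid u} \<union> {mid u..snd u}" using b by auto
    have "strict_mono_on {fst u..snd u} f"
    proof (intro strict_mono_onI)
      fix s t assume st: "s \<in> {fst u..snd u}" "t \<in> {fst u..snd u}" "s < t"
      have m1: "\<And>s t. s \<in> {fst u..mid u} \<Longrightarrow> t \<in> {fst u..mid u} \<Longrightarrow> s < t \<Longrightarrow> f s < f t"
        using l by (auto simp: strict_mono_on_def)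
      have m2: "\<And>s t. s \<in> {mid u..snd u} \<Longrightarrow> t \<in> {mid u..snd u} \<Longrightarrow> s < t \<Longrightarrow> f s < f t"
        using r by (auto simp: strict_mono_on_def)
      consider "t \<le> mid u" | "s \<ge> mid u" | "s < mid u" "mid u < t" by linarith
      then show "f s < f t"
      proof cases
        case 3
        then show ?thesis using m1[of s "mid u"] m2[of "mid u" t] st b by auto
      qed (use m1[of s t] m2[of s t] st in auto)
    qed
    moreover have "continuous_on {fst u..snd u} f"
      unfolding un using l r by (intro continuous_on_closed_Un) auto
    moreover have "f ` {fst u..snd u} = {f (fst u)..f (snd u)}"
    proof -
      have "f (fst u) < f (mid u)" "f (mid u) < f (snd u)"
        using l r b by (auto simp: strict_mono_on_def)
      then show ?thesis unfolding un image_Un using l r by auto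
    qed
    ultimately show "?P u" by blast
  qed
  then show ?thesis by simp
qed

subsection \<open>Thompson's group in terms of standard dyadic intervals\<close>

lemma dyadicI: "x * 2 ^ n \<in> \<int> \<Longrightarrow> x \<in> dyadic"
  unfolding dyadic_def by (force elim!: Ints_cases simp: field_simps)

lemma dyadic_level:
  assumes "c \<in> dyadic" shows "\<exists>N. \<forall>n\<ge>N. c * 2 ^ n \<in> \<int>"
proof -
  obtain p :: int and N :: nat where c: "c = of_int p / 2 ^ N" using assms by (auto simp: dyadic_def)
  have "c * 2 ^ n \<in> \<int>" if "n \<ge> N" for n
  proof -
    have "(2::real) ^ n = 2 ^ N * 2 ^ (n - N)" using that by (simp flip: power_add)
    then have "c * 2 ^ n = of_int (p * 2 ^ (n - N))" by (simp add: c)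
    then show ?thesis by (metis Ints_of_int)
  qed
  then show ?thesis by blast
qed

lemma dyadic_add: assumes "x \<in> dyadic" "y \<in> dyadic" shows "x + y \<in> dyadic"
proof -
  obtain M where M: "\<And>n. n \<ge> M \<Longrightarrow> x * 2 ^ n \<in> \<int>" using dyadic_level assms by blast
  obtain N where N: "\<And>n. n \<ge> N \<Longrightarrow> y * 2 ^ n \<in> \<int>" using dyadic_level assms by blast
  have "(x + y) * 2 ^ (M + N) \<in> \<int>"
    using Ints_add[OF M[of "M + N"] N[of "M + N"]] by (simp add: distrib_right)
  then show ?thesis by (rule dyadicI)
qed

lemma dyadic_uminus: "x \<in> dyadic \<Longrightarrow> - x \<in> dyadic"
  using dyadic_level[of x] dyadicI[of "- x"] by (auto simp: minus_in_Ints_iff)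

lemma dyadic_powi:
  assumes "x \<in> dyadic" shows "2 powi m * x \<in> dyadic"
proof -
  obtain N where N: "\<And>n. n \<ge> N \<Longrightarrow> x * 2 ^ n \<in> \<int>" using dyadic_level assms by blast
  have "2 powi m * x * 2 ^ (N + nat (- m)) = x * 2 ^ (N + nat m)"
    by (cases "m \<ge> 0") (auto simp: power_int_def power_add field_simps)
  moreover have "x * 2 ^ (N + nat m) \<in> \<int>" using N[of "N + nat m"] by simp
  ultimately show ?thesis by (intro dyadicI[of _ "N + nat (- m)"]) (rule ssubst)
qed

lemma dyadic_0: "0 \<in> dyadic" by (rule dyadicI[of _ 0]) simp

lemma dint_side:
  assumes "u \<in> dint n" "c * 2 ^ n \<in> \<int>"
  shows "snd u \<le> c \<or> c \<le> fst u"
proof -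
  obtain w where w: "fst u * 2 ^ n = of_int w" using assms by (auto simp: dint_def elim: Ints_cases)
  obtain z where z: "c * 2 ^ n = of_int z" using assms by (auto elim: Ints_cases)
  have "snd u * 2 ^ n = of_int (w + 1)" using assms w by (auto simp: dint_def distrib_right)
  moreover have "z \<le> w \<or> w + 1 \<le> z" by linarith
  then have "(of_int z :: real) \<le> of_int w \<or> (of_int (w + 1) :: real) \<le> of_int z"
    unfolding of_int_le_iff .
  ultimately have "c * 2 ^ n \<le> fst u * 2 ^ n \<or> snd u * 2 ^ n \<le> c * 2 ^ n" using w z by simp
  then show ?thesis by auto
qed

lemma deep_side:
  assumes "c \<in> dyadic" shows "deep (\<lambda>u. snd u \<le> c \<or> c \<le> fst u)"
  using dyadic_level[OF assms] dint_side unfolding deep_def eventually_sequentially by blast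

lemma deep_ball: "finite A \<Longrightarrow> (\<And>i. i \<in> A \<Longrightarrow> deep (Q i)) \<Longrightarrow> deep (\<lambda>u. \<forall>i\<in>A. Q i u)"
  unfolding deep_def using eventually_ball_finite[of A "\<lambda>n i. \<forall>u\<in>dint n. Q i u" sequentially]
  by (auto elim!: eventually_mono)

lemma deep_mono: "deep P \<Longrightarrow> (\<And>u. u \<in> std \<Longrightarrow> P u \<Longrightarrow> R u) \<Longrightarrow> deep R"
  using deep_mono2[of P P R] by blast

lemma deep_partition:
  assumes "dyadic_partition k a"
  shows "deep (\<lambda>u. \<exists>i\<in>{..<k}. {fst u..snd u} \<subseteq> {a i..a (Suc i)})"
proof (rule deep_mono)
  show "deep (\<lambda>u. \<forall>i\<in>{..k}. snd u \<le> a i \<or> a i \<le> fst u)"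
    using assms by (intro deep_ball deep_side) (auto simp: dyadic_partition_def)
next
  fix u assume u: "u \<in> std" and s: "\<forall>i\<in>{..k}. snd u \<le> a i \<or> a i \<le> fst u"
  have "snd u \<le> a j \<Longrightarrow> j \<le> k \<Longrightarrow> \<exists>i<j. {fst u..snd u} \<subseteq> {a i..a (Suc i)}" for j
  proof (induction j)
    case 0
    then show ?case using std_bounds[OF u] assms by (simp add: dyadic_partition_def)
  next
    case (Suc j)
    show ?case
    proof (cases "snd u \<le> a j")
      case True
      then show ?thesis using Suc less_Suc_eq by auto
    next
      case False
      then have "a j \<le> fst u" using s Suc by force
      then show ?thesis using Suc by (intro exI[of _ j]) auto
    qed
  qed
  from this[of k] show "\<exists>i\<in>{..<k}. {fst u..snd u} \<subseteq> {a i..a (Suc i)}"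
    using std_bounds[OF u] assms by (auto simp: dyadic_partition_def)
qed

lemma level_partition:
  "dyadic_partition (2 ^ n) (\<lambda>i. real i / 2 ^ n)"
  by (auto simp: dyadic_partition_def divide_strict_right_mono intro: dyadicI[of _ n])

lemma level_piece: "i < 2 ^ n \<Longrightarrow> (real i / 2 ^ n, real (Suc i) / 2 ^ n) \<in> dint n"
proof -
  assume "i < 2 ^ n"
  then have "real (Suc i) \<le> real (2 ^ n)" unfolding of_nat_le_iff by simp
  then show ?thesis by (auto simp: dint_def add_divide_distrib[symmetric] add.commute)
qed

lemma lin_affine:
  assumes "\<And>t. t \<in> {fst u..snd u} \<Longrightarrow> f t = s * t + c" "fst u < snd u" "t \<in> {fst u..snd u}"
  shows "f t = lin u (img f u) t"
proof -
  have "f (snd u) - f (fst u) = s * (snd u - fst u)"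
    using assms(1)[of "fst u"] assms(1)[of "snd u"] assms(2) by (simp add: algebra_simps)
  then have "lin u (img f u) t = f (fst u) + s * (t - fst u)" using assms(2) by (simp add: lin_def)
  then show ?thesis using assms(1)[of "fst u"] assms(1)[OF assms(3)] assms(2) by (simp add: algebra_simps)
qed

lemma thompson_carrierE:
  assumes "f \<in> thompson_carrier"
  obtains k a where "dyadic_partition k a"
    "\<And>i. i < k \<Longrightarrow> \<exists>m c. \<forall>x\<in>{a i..a (Suc i)}. f x = 2 powi m * x + c"
    "strict_mono_on {0..1} f" "f 0 = 0" "f 1 = 1" "\<And>i. i \<le> k \<Longrightarrow> f (a i) \<in> dyadic"
    "bij_betw f {0..1} {0..1}" "f \<in> extensional {0..1}"
proof -
  obtain k a where p: "dyadic_partition k a"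
    and lin: "\<And>i. i < k \<Longrightarrow> \<exists>m c. \<forall>x\<in>{a i..a (Suc i)}. f x = 2 powi m * x + c"
    using assms unfolding thompson_carrier_def by blast
  have b: "bij_betw f {0..1} {0..1}" and e: "f \<in> extensional {0..1}"
    using assms by (auto simp: thompson_carrier_def Bij_def)
  have a0: "a 0 = 0" "a k = 1" and aS: "\<And>i. i < k \<Longrightarrow> a i < a (Suc i)"
    and ad: "\<And>i. i \<le> k \<Longrightarrow> a i \<in> dyadic"
    using p by (auto simp: dyadic_partition_def)
  have "strict_mono_on {0..a j} f \<and> 0 \<le> a j" if "j \<le> k" for j using that
  proof (induction j)
    case 0 then show ?case using a0 by (simp add: strict_mono_on_def)
  next
    case (Suc j)
    then have IH: "\<And>s t. 0 \<le> s \<Longrightarrow> s < t \<Longrightarrow> t \<le> a j \<Longrightarrow> f s < f t" "0 \<le> a j"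
      by (auto simp: strict_mono_on_def)
    obtain m c where mc: "\<forall>x\<in>{a j..a (Suc j)}. f x = 2 powi m * x + c" using lin Suc by force
    have *: "a j \<le> s \<Longrightarrow> s < t \<Longrightarrow> t \<le> a (Suc j) \<Longrightarrow> f s < f t" for s t
      using mc by simp
    have "f s < f t" if "0 \<le> s" "s < t" "t \<le> a (Suc j)" for s t
    proof -
      consider "t \<le> a j" | "s \<ge> a j" | "s < a j" "a j < t" by linarith
      then show ?thesis
      proof cases
        case 3 then show ?thesis using IH(1)[of s "a j"] *[of "a j" t] that by force
      qed (use IH * that in auto)
    qed
    then show ?case using aS[of j] Suc.prems IH by (auto intro!: strict_mono_onI)
  qed
  then have m: "strict_mono_on {0..1} f" using a0 by force
  have mono: "0 \<le> s \<Longrightarrow> s \<le> t \<Longrightarrow> t \<le> 1 \<Longrightarrow> f s \<le> f t" for s t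
    using m by (cases "s = t") (auto simp: strict_mono_on_def less_eq_real_def)
  have im: "f ` {0..1} = {0..1}" using b by (simp add: bij_betw_def)
  have f0: "f 0 = 0"
  proof -
    obtain t where "t \<in> {0..1}" "f t = 0" using im by (metis atLeastAtMost_iff imageE le_numeral_extra(3) zero_le_one)
    moreover have "f 0 \<in> {0..1}" using im by auto
    ultimately show ?thesis using mono[of 0 t] by force
  qed
  have f1: "f 1 = 1"
  proof -
    obtain t where "t \<in> {0..1}" "f t = 1" using im by (metis atLeastAtMost_iff imageE order_refl zero_le_one)
    moreover have "f 1 \<in> {0..1}" using im by auto
    ultimately show ?thesis using mono[of t 1] by force
  qed
  have "i \<le> k \<Longrightarrow> f (a i) \<in> dyadic" for i
  proof (induction i)
    case 0 then show ?case using a0 f0 dyadic_0 by simp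
  next
    case (Suc i)
    obtain m c where mc: "\<forall>x\<in>{a i..a (Suc i)}. f x = 2 powi m * x + c" using lin Suc by force
    have eq: "f (a (Suc i)) = f (a i) + 2 powi m * (a (Suc i) + - a i)"
      using mc aS[of i] Suc.prems by (auto simp: algebra_simps)
    show ?case unfolding eq using Suc ad[of i] ad[of "Suc i"]
      by (intro dyadic_add dyadic_powi dyadic_uminus) auto
  qed
  then show thesis using that p lin m f0 f1 b e by blast
qed

lemma good_affine:
  assumes f: "\<And>t. t \<in> {fst u..snd u} \<Longrightarrow> f t = 2 powi m * t + c"
    and u: "u \<in> dint n" and r: "0 \<le> f (fst u)" "f (snd u) \<le> 1"
    and p: "int p = int n - m" and z: "f (fst u) * 2 ^ p \<in> \<int>"
  shows "good f u"
proof -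
  note b = dint_bounds[OF u]
  have "(2::real) ^ n = 2 powi m * 2 ^ p"
    using p by (simp add: power_int_add[symmetric] flip: power_int_of_nat)
  moreover have "snd u = fst u + 1 / 2 ^ n" using u by (simp add: dint_def)
  ultimately have "f (snd u) = f (fst u) + 1 / 2 ^ p"
    using b f[of "fst u"] f[of "snd u"] by (simp add: field_simps)
  then have "img f u \<in> dint p" using r z by (auto simp: dint_def)
  then show ?thesis unfolding good_def using lin_affine[OF f b(5)] dint_std by blast
qed

lemma thompson_deep_good:
  assumes "f \<in> thompson_carrier"
  shows "deep (good f)"
proof -
  obtain k a where p: "dyadic_partition k a"
    and lin: "\<And>i. i < k \<Longrightarrow> \<exists>m c. \<forall>x\<in>{a i..a (Suc i)}. f x = 2 powi m * x + c"
    and fd: "\<And>i. i \<le> k \<Longrightarrow> f (a i) \<in> dyadic" and b: "bij_betw f {0..1} {0..1}"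
    using thompson_carrierE[OF assms] by metis
  have ad: "\<And>i. i \<le> k \<Longrightarrow> a i \<in> dyadic" using p by (auto simp: dyadic_partition_def)
  have "deep (\<lambda>u. {fst u..snd u} \<subseteq> {a i..a (Suc i)} \<longrightarrow> good f u)" if i: "i < k" for i
  proof -
    obtain m c where mc: "\<And>x. x\<in>{a i..a (Suc i)} \<Longrightarrow> f x = 2 powi m * x + c" using lin i by force
    obtain M where M: "\<And>n. n \<ge> M \<Longrightarrow> a i * 2 ^ n \<in> \<int>" using dyadic_level ad i by (meson less_imp_le)
    obtain N where N: "\<And>n. n \<ge> N \<Longrightarrow> f (a i) * 2 ^ n \<in> \<int>" using dyadic_level fd i by (meson less_imp_le)
    have "good f u" if n: "n \<ge> M + N + nat m" and u: "u \<in> dint n"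
      and s: "{fst u..snd u} \<subseteq> {a i..a (Suc i)}" for n u
    proof -
      define p where "p = nat (int n - m)"
      have p: "int p = int n - m" "p \<ge> N" using n by (auto simp: p_def)
      have pw: "(2::real) ^ n = 2 powi m * 2 ^ p"
        using p by (simp add: power_int_add[symmetric] flip: power_int_of_nat)
      note bd = dint_bounds[OF u]
      have le: "a i \<le> fst u" "snd u \<le> a (Suc i)" using s bd by auto
      have "f (fst u) * 2 ^ p = f (a i) * 2 ^ p + (fst u * 2 ^ n - a i * 2 ^ n)"
        using mc[of "a i"] mc[of "fst u"] le bd unfolding pw by (simp add: algebra_simps)
      also have "\<dots> \<in> \<int>"
        using N[OF p(2)] M[of n] n u by (intro Ints_add Ints_diff) (auto simp: dint_def)
      finally have z: "f (fst u) * 2 ^ p \<in> \<int>" .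
      have "f (fst u) \<in> {0..1}" "f (snd u) \<in> {0..1}" using bd b by (auto simp: bij_betw_def)
      then have r: "0 \<le> f (fst u)" "f (snd u) \<le> 1" by auto
      show ?thesis by (rule good_affine[of u f m c n p, OF _ u r p(1) z]) (use s mc in blast)
    qed
    then show ?thesis unfolding deep_def eventually_sequentially by blast
  qed
  then have "deep (\<lambda>u. \<forall>i\<in>{..<k}. {fst u..snd u} \<subseteq> {a i..a (Suc i)} \<longrightarrow> good f u)"
    by (intro deep_ball) auto
  then show ?thesis using deep_partition[OF p] by (rule deep_mono2) blast
qed

lemma thompson_carrierI:
  assumes e: "f \<in> extensional {0..1}" and f0: "f 0 = 0" and f1: "f 1 = 1"
    and g: "\<forall>u\<in>dint n. good f u"
  shows "f \<in> thompson_carrier"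
proof -
  note ms = good_level_mono_surj[OF g]
  have m: "strict_mono_on {0..1} f" and im: "f ` {0..1} = {0..1}" and c: "continuous_on {0..1} f"
    using ms f0 f1 by auto
  have inj: "inj_on f {0..1}" using m strict_mono_on_imp_inj_on by blast
  have "f \<in> Bij {0..1}" using e inj im by (simp add: Bij_def bij_betw_def)
  moreover have "\<exists>h. homeomorphism {0..1} {0..1} f h"
    using homeomorphism_compact[OF _ c im inj] by (simp add: compact_Icc)
  moreover have "\<exists>m c. \<forall>x\<in>{real i / 2 ^ n..real (Suc i) / 2 ^ n}. f x = 2 powi m * x + c"
    if "i < 2 ^ n" for i
  proof -
    let ?u = "(real i / 2 ^ n, real (Suc i) / 2 ^ n)"
    have u: "?u \<in> dint n" using level_piece that by blast
    then have gu: "good f ?u" using g by blast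
    then obtain p where p: "img f ?u \<in> dint p" using img_std unfolding std_def by blast
    let ?v = "img f ?u"
    have "f x = 2 powi (int n - int p) * x + (fst ?v - 2 powi (int n - int p) * fst ?u)"
      if "x \<in> {fst ?u..snd ?u}" for x
    proof -
      have d: "snd ?u - fst ?u = 1 / 2 ^ n" "snd ?v - fst ?v = 1 / 2 ^ p"
        using u p unfolding dint_def by auto
      have "f x = fst ?v + (1 / 2 ^ p) * ((x - fst ?u) / (1 / 2 ^ n))"
        using goodD[OF gu that] unfolding lin_def d .
      moreover have "2 powi (int n - int p) = (1 / 2 ^ p) / (1 / 2 ^ n :: real)"
        by (simp add: power_int_diff)
      ultimately show ?thesis by (simp only: times_divide_eq_left times_divide_eq_right right_diff_distrib diff_divide_distrib)
    qed
    then show ?thesis unfolding fst_conv snd_conv by blast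
  qed
  ultimately show ?thesis using level_partition[of n] unfolding thompson_carrier_def by blast
qed

lemma thompson_carrier_iff:
  "f \<in> thompson_carrier \<longleftrightarrow> f \<in> extensional {0..1} \<and> f 0 = 0 \<and> f 1 = 1 \<and> deep (good f)"
  using thompson_carrierI[of f] thompson_deep_good[of f] deep_level[of "good f"]
    thompson_carrierE[of f] by metis

lemma good_cong:
  assumes "\<And>t. t \<in> {fst u..snd u} \<Longrightarrow> f t = g t" "fst u \<le> snd u"
  shows "good f u = good g u" "img f u = img g u"
  using assms by (auto simp: good_def img_def)

lemma good_comp:
  assumes u: "u \<in> std" and g: "good g u" and f: "good f (img g u)"
    and h: "\<And>t. t \<in> {fst u..snd u} \<Longrightarrow> h t = f (g t)"
  shows "good h u" "img h u = img f (img g u)"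
proof -
  note b = std_bounds[OF u] and bi = std_bounds[OF img_std[OF g]] and bf = std_bounds[OF img_std[OF f]]
  show i: "img h u = img f (img g u)" using h b by (auto simp: img_def)
  have "h t = lin u (img h u) t" if t: "t \<in> {fst u..snd u}" for t
  proof -
    have "g t = lin u (img g u) t" using goodD[OF g t] .
    moreover have "lin u (img g u) t \<in> {fst (img g u)..snd (img g u)}"
      using lin_range[OF b(5) bi(5) t] .
    ultimately show ?thesis using goodD[OF f] h[OF t] lin_lin[OF b(5) bi(5)] i by simp
  qed
  then show "good h u" using i img_std[OF f] by (simp add: good_def)
qed

lemma good_inv:
  assumes u: "u \<in> std" and f: "good f u" and g: "\<And>t. t \<in> {fst u..snd u} \<Longrightarrow> g (f t) = t"
  shows "good g (img f u)" "img g (img f u) = u"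
proof -
  note b = std_bounds[OF u] and bi = std_bounds[OF img_std[OF f]]
  show i: "img g (img f u) = u" using g b by (auto simp: img_def)
  have "g s = lin (img f u) u s" if s: "s \<in> {fst (img f u)..snd (img f u)}" for s
  proof -
    let ?t = "lin (img f u) u s"
    have t: "?t \<in> {fst u..snd u}" using lin_range[OF bi(5) b(5) s] .
    have "f ?t = s" using goodD[OF f t] b bi by (simp add: lin_lin lin_self)
    then show ?thesis using g[OF t] by simp
  qed
  then show "good g (img f u)" using u i by (simp add: good_def)
qed

lemma thompson_subgroup: "subgroup thompson_carrier (BijGroup {0..1})"
proof
  show "thompson_carrier \<subseteq> carrier (BijGroup {0..1})"
    by (auto simp: thompson_carrier_def BijGroup_def)
  fix f g assume f: "f \<in> thompson_carrier" and g: "g \<in> thompson_carrier"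
  have eq: "f \<otimes>\<^bsub>BijGroup {0..1}\<^esub> g = compose {0..1} f g"
    using f g by (auto simp: thompson_carrier_def BijGroup_def)
  have "deep (good g)" "deep (good f)" using f g by (auto simp: thompson_carrier_iff)
  have "deep (good (compose {0..1} f g))"
  proof (rule deep_mono2[OF \<open>deep (good g)\<close> deep_img[OF \<open>deep (good g)\<close> \<open>deep (good f)\<close>]])
    fix u assume u: "u \<in> std" "good g u" "good f (img g u)"
    show "good (compose {0..1} f g) u"
      using std_bounds[OF u(1)] by (intro good_comp[OF u]) (auto simp: compose_def)
  qed
  then show "f \<otimes>\<^bsub>BijGroup {0..1}\<^esub> g \<in> thompson_carrier"
    unfolding eq using f g by (auto simp: thompson_carrier_iff compose_def)
next
  show "\<one>\<^bsub>BijGroup {0..1}\<^esub> \<in> thompson_carrier"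
    by (rule thompson_carrierI[where n=0])
      (auto simp: BijGroup_def good_def img_def lin_def)
next
  fix f assume f: "f \<in> thompson_carrier"
  obtain k a where p: "dyadic_partition k a"
    and lin: "\<And>i. i < k \<Longrightarrow> \<exists>m c. \<forall>x\<in>{a i..a (Suc i)}. f x = 2 powi m * x + c"
    and fm: "strict_mono_on {0..1} f" and f0: "f 0 = 0" and f1: "f 1 = 1"
    and fd: "\<And>i. i \<le> k \<Longrightarrow> f (a i) \<in> dyadic"
    and b: "bij_betw f {0..1} {0..1}" and e: "f \<in> extensional {0..1}"
    using thompson_carrierE[OF f] by metis
  have fB: "f \<in> Bij {0..1}" using f by (auto simp: thompson_carrier_def)
  define g where "g = (\<lambda>x\<in>{0..1}. inv_into {0..1} f x)"
  have eq: "inv\<^bsub>BijGroup {0..1}\<^esub> f = g" using inv_BijGroup[OF fB] by (simp add: g_def)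
  have gB: "g \<in> Bij {0..1}" unfolding g_def using restrict_inv_into_Bij[OF fB] .
  have gf: "g (f t) = t" if "t \<in> {0..1}" for t
    using that b by (auto simp: g_def bij_betw_def inv_into_f_f)
  have fg: "f (g t) = t" "g t \<in> {0..1}" if "t \<in> {0..1}" for t
    using that b inv_into_into[of t f "{0..1}"] unfolding g_def by (auto simp: bij_betw_def f_inv_into_f)
  obtain h where h: "homeomorphism {0..1} {0..1} f h" using f by (auto simp: thompson_carrier_def)
  have "h t = g t" if "t \<in> {0..1}" for t
    using h that fg[OF that] by (metis homeomorphism_def)
  then have "homeomorphism {0..1} {0..1} g f"
    using homeomorphism_symD[OF h] homeomorphism_cong by metis
  moreover have aS: "a i < a (Suc i)" "0 \<le> a i" "a (Suc i) \<le> 1" if i: "i < k" for i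
  proof -
    show "a i < a (Suc i)" using p i by (auto simp: dyadic_partition_def)
    have "j \<le> k \<Longrightarrow> 0 \<le> a j" for j
    proof (induction j)
      case (Suc j)
      then have "a j < a (Suc j)" using p by (auto simp: dyadic_partition_def)
      then show ?case using Suc by simp
    qed (use p in \<open>simp add: dyadic_partition_def\<close>)
    then show "0 \<le> a i" using i by simp
    have "d \<le> k \<Longrightarrow> a (k - d) \<le> 1" for d
    proof (induction d)
      case (Suc d)
      then have "a (k - Suc d) < a (Suc (k - Suc d))" using p by (auto simp: dyadic_partition_def)
      then show ?case using Suc by (simp add: Suc_diff_Suc)
    qed (use p in \<open>simp add: dyadic_partition_def\<close>)
    from this[of "k - Suc i"] show "a (Suc i) \<le> 1" using i by simp
  qed
  moreover have "f (a i) < f (a (Suc i))" if "i < k" for i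
    using aS[OF that] by (intro strict_mono_onD[OF fm]) auto
  then have "dyadic_partition k (\<lambda>i. f (a i))"
    using p f0 f1 fd by (auto simp: dyadic_partition_def)
  moreover have "\<exists>m c. \<forall>x\<in>{f (a i)..f (a (Suc i))}. g x = 2 powi m * x + c" if i: "i < k" for i
  proof -
    obtain m c where mc: "\<And>x. x \<in> {a i..a (Suc i)} \<Longrightarrow> f x = 2 powi m * x + c" using lin i by blast
    have "g y = 2 powi (- m) * y + (- (2 powi (- m) * c))" if y: "y \<in> {f (a i)..f (a (Suc i))}" for y
    proof -
      have r: "f (a i) \<in> {0..1}" "f (a (Suc i)) \<in> {0..1}" using aS[OF i] b by (auto simp: bij_betw_def)
      then have y01: "y \<in> {0..1}" using y by auto
      have "\<not> g y < a i"
        using strict_mono_onD[OF fm, of "g y" "a i"] fg[OF y01] aS[OF i] y by auto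
      moreover have "\<not> g y > a (Suc i)"
        using strict_mono_onD[OF fm, of "a (Suc i)" "g y"] fg[OF y01] aS[OF i] y by auto
      ultimately have "f (g y) = 2 powi m * g y + c" by (intro mc) auto
      then have "y = 2 powi m * g y + c" using fg y01 by simp
      then show ?thesis by (simp add: power_int_minus field_simps)
    qed
    then show ?thesis by blast
  qed
  ultimately show "inv\<^bsub>BijGroup {0..1}\<^esub> f \<in> thompson_carrier"
    unfolding eq thompson_carrier_def using gB by blast
qed

abbreviation (input) "F \<equiv> thompson_F"

lemma carrier_F [simp]: "carrier F = thompson_carrier"
  by (simp add: thompson_F_def)

interpretation F: group F
  unfolding thompson_F_def
  by (rule subgroup.subgroup_is_group[OF thompson_subgroup group_BijGroup])

lemma F_mult: "f \<in> thompson_carrier \<Longrightarrow> g \<in> thompson_carrier \<Longrightarrow> t \<in> {0..1} \<Longrightarrow> (f \<otimes>\<^bsub>F\<^esub> g) t = f (g t)"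
  by (auto simp: thompson_F_def BijGroup_def thompson_carrier_def compose_def)

lemma F_one: "t \<in> {0..1} \<Longrightarrow> \<one>\<^bsub>F\<^esub> t = t"
  by (auto simp: thompson_F_def BijGroup_def)

lemma F_range: "f \<in> thompson_carrier \<Longrightarrow> t \<in> {0..1} \<Longrightarrow> f t \<in> {0..1}"
  by (auto simp: thompson_carrier_def Bij_def bij_betw_def)

lemma F_ends: "f \<in> thompson_carrier \<Longrightarrow> f 0 = 0" "f \<in> thompson_carrier \<Longrightarrow> f 1 = 1"
  by (simp_all add: thompson_carrier_iff)

lemma F_less: "f \<in> thompson_carrier \<Longrightarrow> 0 \<le> s \<Longrightarrow> t \<le> 1 \<Longrightarrow> s < t \<Longrightarrow> f s < f t"
  by (auto elim!: thompson_carrierE simp: strict_mono_on_def)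

lemma F_le: "f \<in> thompson_carrier \<Longrightarrow> 0 \<le> s \<Longrightarrow> t \<le> 1 \<Longrightarrow> s \<le> t \<Longrightarrow> f s \<le> f t"
  using F_less[of f s t] by (cases "s = t") auto

lemma F_inv:
  assumes "f \<in> thompson_carrier" "t \<in> {0..1}"
  shows "(inv\<^bsub>F\<^esub> f) (f t) = t" "f ((inv\<^bsub>F\<^esub> f) t) = t"
  using assms F_mult[of "inv\<^bsub>F\<^esub> f" f t] F_mult[of f "inv\<^bsub>F\<^esub> f" t] F_one F.inv_closed[of f] by auto

lemma F_eqI:
  assumes "f \<in> thompson_carrier" "g \<in> thompson_carrier" "\<And>t. t \<in> {0..1} \<Longrightarrow> f t = g t"
  shows "f = g"
  using assms by (intro extensionalityI[of f "{0..1}" g]) (auto simp: thompson_carrier_iff)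

lemma F_deep: "f \<in> thompson_carrier \<Longrightarrow> deep (good f)"
  by (simp add: thompson_carrier_iff)

lemma std_in: "u \<in> std \<Longrightarrow> t \<in> {fst u..snd u} \<Longrightarrow> t \<in> {0..1}"
  using std_bounds(1,4)[of u] unfolding atLeastAtMost_iff by linarith

lemma good_mult:
  assumes "f \<in> thompson_carrier" "g \<in> thompson_carrier" "u \<in> std" "good g u" "good f (img g u)"
  shows "good (f \<otimes>\<^bsub>F\<^esub> g) u"
  by (rule good_comp(1)[OF assms(3-5)]) (rule F_mult[OF assms(1,2) std_in[OF assms(3)]])

lemma img_mult:
  assumes "f \<in> thompson_carrier" "g \<in> thompson_carrier" "u \<in> std"
  shows "img (f \<otimes>\<^bsub>F\<^esub> g) u = img f (img g u)"
  using assms std_bounds[of u] by (simp add: img_def F_mult)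

lemma good_inv_F:
  assumes "f \<in> thompson_carrier" "u \<in> std" "good f u"
  shows "good (inv\<^bsub>F\<^esub> f) (img f u)" "img (inv\<^bsub>F\<^esub> f) (img f u) = u"
  by (rule good_inv[OF assms(2,3)], rule F_inv(1)[OF assms(1) std_in[OF assms(2)]], assumption)+

subsection \<open>Closures\<close>

definition agree :: "(real \<Rightarrow> real) set \<Rightarrow> (real \<Rightarrow> real) \<Rightarrow> ivl \<Rightarrow> bool" where
  "agree H f u \<longleftrightarrow> (\<exists>h\<in>H. \<forall>t\<in>{fst u..snd u}. f t = h t)"

lemma agree_self: "h \<in> H \<Longrightarrow> agree H h u"
  unfolding agree_def by blast

lemma deep_agree_self: "h \<in> H \<Longrightarrow> deep (agree H h)"
  unfolding deep_def by (simp add: agree_self)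

lemma Cl_iff: "f \<in> Cl H \<longleftrightarrow> f \<in> thompson_carrier \<and> deep (agree H f)"
proof (intro iffI conjI)
  assume f: "f \<in> Cl H"
  then show "f \<in> thompson_carrier" by (simp add: Cl_def)
  obtain k a h where p: "dyadic_partition k a"
    and h: "\<And>i. i < k \<Longrightarrow> h i \<in> H \<and> (\<forall>x\<in>{a i..a (Suc i)}. f x = h i x)"
    using f unfolding Cl_def by blast
  show "deep (agree H f)"
    using deep_partition[OF p]
  proof (rule deep_mono)
    fix u assume "\<exists>i\<in>{..<k}. {fst u..snd u} \<subseteq> {a i..a (Suc i)}"
    then obtain i where "i < k" "{fst u..snd u} \<subseteq> {a i..a (Suc i)}" by blast
    then show "agree H f u" using h unfolding agree_def by blast
  qed
next
  assume f: "f \<in> thompson_carrier \<and> deep (agree H f)"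
  then obtain n where "\<forall>u\<in>dint n. agree H f u" using deep_level by blast
  then have "\<forall>i<2 ^ n. agree H f (real i / 2 ^ n, real (Suc i) / 2 ^ n)" using level_piece by blast
  then obtain h where
    "\<forall>i<2 ^ n. h i \<in> H \<and> (\<forall>x\<in>{real i / 2 ^ n..real (Suc i) / 2 ^ n}. f x = h i x)"
    unfolding agree_def fst_conv snd_conv by metis
  then show "f \<in> Cl H" using f level_partition unfolding Cl_def carrier_F by blast
qed

definition glue :: "real \<Rightarrow> (real \<Rightarrow> real) \<Rightarrow> (real \<Rightarrow> real) \<Rightarrow> real \<Rightarrow> real" where
  "glue c f g = (\<lambda>t\<in>{0..1}. if t \<le> c then f t else g t)"

lemma glue_left: "t \<in> {0..1} \<Longrightarrow> t \<le> c \<Longrightarrow> glue c f g t = f t"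
  by (simp add: glue_def)

lemma glue_right: "t \<in> {0..1} \<Longrightarrow> c \<le> t \<Longrightarrow> f c = g c \<Longrightarrow> glue c f g t = g t"
  by (auto simp: glue_def)

lemma deep_glue:
  assumes "c \<in> dyadic" "f c = g c" "deep (Q f)" "deep (Q g)"
    and cong: "\<And>f h u. (\<And>t. t \<in> {fst u..snd u} \<Longrightarrow> h t = f t) \<Longrightarrow> u \<in> std \<Longrightarrow> Q f u \<Longrightarrow> Q h u"
  shows "deep (Q (glue c f g))"
proof -
  have "deep (\<lambda>u. Q f u \<and> Q g u)" using assms(3,4) by (rule deep_mono2) blast
  then show ?thesis using deep_side[OF assms(1)]
  proof (rule deep_mono2)
    fix u assume u: "u \<in> std" and q: "Q f u \<and> Q g u" and s: "snd u \<le> c \<or> c \<le> fst u"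
    note i = std_in[OF u]
    show "Q (glue c f g) u"
    proof (cases "snd u \<le> c")
      case True
      then have "glue c f g t = f t" if "t \<in> {fst u..snd u}" for t
        using i[OF that] that by (auto intro: glue_left)
      then show ?thesis using cong u q by blast
    next
      case False
      then have "glue c f g t = g t" if "t \<in> {fst u..snd u}" for t
        using i[OF that] that s assms(2) by (auto intro: glue_right)
      then show ?thesis using cong u q by blast
    qed
  qed
qed

lemma glue_F:
  assumes f: "f \<in> thompson_carrier" and g: "g \<in> thompson_carrier"
    and c: "c \<in> dyadic" "c \<in> {0..1}" "f c = g c"
  shows "glue c f g \<in> thompson_carrier"
proof -
  have "deep (good (glue c f g))"
    using c(1,3) F_deep[OF f] F_deep[OF g]
    by (rule deep_glue) (metis good_cong(1) less_imp_le std_bounds(5))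
  moreover have "glue c f g 0 = 0" "glue c f g 1 = 1"
    using c F_ends[OF f] F_ends[OF g] by (auto simp: glue_def)
  ultimately show ?thesis unfolding thompson_carrier_iff by (simp add: glue_def)
qed

lemma glue_Cl:
  assumes f: "f \<in> Cl H" and g: "g \<in> Cl H" and c: "c \<in> dyadic" "c \<in> {0..1}" "f c = g c"
  shows "glue c f g \<in> Cl H"
proof -
  have "deep (agree H (glue c f g))"
    using c(1,3) f g unfolding Cl_iff
    by (intro deep_glue[where Q="agree H"]) (auto simp: agree_def)
  then show ?thesis using f g c glue_F unfolding Cl_iff by blast
qed

lemma Cl_subgroup:
  assumes H: "subgroup H F" shows "subgroup (Cl H) F"
proof -
  interpret H: subgroup H F by (rule H)
  have HF: "h \<in> H \<Longrightarrow> h \<in> thompson_carrier" for h using H.subset by auto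
  show ?thesis
  proof (rule F.subgroupI)
    show "Cl H \<subseteq> carrier F" by (auto simp: Cl_def)
    have "\<one>\<^bsub>F\<^esub> \<in> Cl H" unfolding Cl_iff
      using deep_agree_self[OF H.one_closed] F.one_closed by simp
    then show "Cl H \<noteq> {}" by blast
  next
    fix f assume f: "f \<in> Cl H"
    let ?g = "inv\<^bsub>F\<^esub> f"
    have fF: "f \<in> thompson_carrier" and df: "deep (agree H f)" using f by (auto simp: Cl_iff)
    have gF: "?g \<in> thompson_carrier" using F.inv_closed[of f] fF by simp
    have "deep (agree H ?g)" using F_deep[OF gF] deep_img[OF F_deep[OF gF] df]
    proof (rule deep_mono2)
      fix u assume u: "u \<in> std" and gd: "good ?g u" and a: "agree H f (img ?g u)"
      obtain h where h: "h \<in> H" "\<And>t. t \<in> {?g (fst u)..?g (snd u)} \<Longrightarrow> f t = h t"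
        using a by (auto simp: agree_def)
      have "?g t = (inv\<^bsub>F\<^esub> h) t" if t: "t \<in> {fst u..snd u}" for t
      proof -
        have t01: "t \<in> {0..1}" using std_in[OF u t] .
        have "?g t \<in> {?g (fst u)..?g (snd u)}"
          using t std_bounds[OF u] by (auto intro!: F_le[OF gF])
        then have "h (?g t) = t" using h(2) F_inv(2)[OF fF t01] by simp
        then show ?thesis using F_inv(1)[OF HF[OF h(1)] F_range[OF gF t01]] by simp
      qed
      then show "agree H ?g u" using H.m_inv_closed[OF h(1)] unfolding agree_def by blast
    qed
    then show "?g \<in> Cl H" using gF by (simp add: Cl_iff)
  next
    fix f g assume f: "f \<in> Cl H" and g: "g \<in> Cl H"
    have fF: "f \<in> thompson_carrier" and df: "deep (agree H f)" using f by (auto simp: Cl_iff)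
    have gF: "g \<in> thompson_carrier" and dg: "deep (agree H g)" using g by (auto simp: Cl_iff)
    have "deep (agree H (f \<otimes>\<^bsub>F\<^esub> g))" using dg deep_img[OF F_deep[OF gF] df]
    proof (rule deep_mono2)
      fix u assume u: "u \<in> std" and ag: "agree H g u" and a: "agree H f (img g u)"
      obtain h where h: "h \<in> H" "\<And>t. t \<in> {g (fst u)..g (snd u)} \<Longrightarrow> f t = h t"
        using a by (auto simp: agree_def)
      obtain k where k: "k \<in> H" "\<And>t. t \<in> {fst u..snd u} \<Longrightarrow> g t = k t"
        using ag unfolding agree_def by blast
      have "(f \<otimes>\<^bsub>F\<^esub> g) t = (h \<otimes>\<^bsub>F\<^esub> k) t" if t: "t \<in> {fst u..snd u}" for t
      proof -
        have t01: "t \<in> {0..1}" using std_in[OF u t] .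
        have "g t \<in> {g (fst u)..g (snd u)}"
          using t std_bounds[OF u] by (auto intro!: F_le[OF gF])
        then show ?thesis using h(2) k(2)[OF t] F_mult[OF fF gF t01] F_mult[OF HF[OF h(1)] HF[OF k(1)] t01]
          by simp
      qed
      then show "agree H (f \<otimes>\<^bsub>F\<^esub> g) u" using H.m_closed[OF h(1) k(1)] unfolding agree_def by blast
    qed
    then show "f \<otimes>\<^bsub>F\<^esub> g \<in> Cl H" using F.m_closed[of f g] fF gF by (simp add: Cl_iff)
  qed
qed

lemma subset_Cl: "H \<subseteq> thompson_carrier \<Longrightarrow> H \<subseteq> Cl H"
  by (auto simp: Cl_iff deep_agree_self)

subsection \<open>The size of an element\<close>

text \<open>The number of carets in the reduced tree diagram of \<open>f\<close> is the cardinality of \<open>bad f\<close>.\<close>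

definition bad :: "(real \<Rightarrow> real) \<Rightarrow> ivl set" where
  "bad f = {u \<in> std. \<not> good f u}"

lemma finite_bad:
  assumes "f \<in> thompson_carrier" shows "finite (bad f)"
proof -
  obtain n where n: "\<And>m u. m \<ge> n \<Longrightarrow> u \<in> dint m \<Longrightarrow> good f u"
    using F_deep[OF assms] unfolding deep_def eventually_sequentially by blast
  have "bad f \<subseteq> (\<Union>m<n. dint m)"
  proof
    fix u assume "u \<in> bad f"
    then obtain m where "u \<in> dint m" "\<not> good f u" by (auto simp: bad_def std_def)
    then show "u \<in> (\<Union>m<n. dint m)" using n[of m u] by (cases "m < n") auto
  qed
  then show ?thesis by (rule finite_subset) simp
qed

lemma img_one: "u \<in> std \<Longrightarrow> img \<one>\<^bsub>F\<^esub> u = u"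
  using std_bounds[of u] by (simp add: img_def F_one)

lemma good_one: assumes u: "u \<in> std" shows "good \<one>\<^bsub>F\<^esub> u"
  unfolding good_def img_one[OF u]
  using F_one[OF std_in[OF u]] lin_self[OF std_bounds(5)[OF u]] u by auto

lemma card_bad_one: "card (bad \<one>\<^bsub>F\<^esub>) = 0"
proof -
  have "bad \<one>\<^bsub>F\<^esub> = {}" using good_one by (auto simp: bad_def)
  then show ?thesis by simp
qed

lemma F_inj: "f \<in> thompson_carrier \<Longrightarrow> s \<in> {0..1} \<Longrightarrow> t \<in> {0..1} \<Longrightarrow> f s = f t \<Longrightarrow> s = t"
  using F_inv(1) by metis

lemma card_bad_mult:
  assumes f: "f \<in> thompson_carrier" and g: "g \<in> thompson_carrier"
  shows "card (bad (f \<otimes>\<^bsub>F\<^esub> g)) \<le> card (bad f) + card (bad g)"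
proof -
  let ?C = "{u \<in> std. good g u \<and> img g u \<in> bad f}"
  have inj: "inj_on (img g) std"
  proof
    fix u v assume u: "u \<in> std" and v: "v \<in> std" and eq: "img g u = img g v"
    have "fst u \<in> {0..1}" "snd u \<in> {0..1}" "fst v \<in> {0..1}" "snd v \<in> {0..1}"
      using std_bounds[OF u] std_bounds[OF v] by auto
    then show "u = v" using F_inj[OF g] eq unfolding img_def by (metis Pair_inject prod_eq_iff)
  qed
  then have inj: "inj_on (img g) ?C" by (rule inj_on_subset) auto
  have im: "img g ` ?C \<subseteq> bad f" by auto
  have fin: "finite ?C" using inj im finite_bad[OF f] by (meson finite_imageD finite_subset)
  have "bad (f \<otimes>\<^bsub>F\<^esub> g) \<subseteq> bad g \<union> ?C"
    using good_mult[OF f g] img_std by (auto simp: bad_def)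
  then have "card (bad (f \<otimes>\<^bsub>F\<^esub> g)) \<le> card (bad g \<union> ?C)"
    using finite_bad[OF g] fin by (intro card_mono) auto
  also have "\<dots> \<le> card (bad g) + card ?C" by (rule card_Un_le)
  also have "card ?C \<le> card (bad f)" using card_inj_on_le[OF inj im finite_bad[OF f]] .
  finally show ?thesis by simp
qed

lemma card_bad_foldr:
  assumes "set w \<subseteq> thompson_carrier" "\<And>s. s \<in> set w \<Longrightarrow> card (bad s) \<le> M"
  shows "foldr (\<otimes>\<^bsub>F\<^esub>) w \<one>\<^bsub>F\<^esub> \<in> thompson_carrier \<and> card (bad (foldr (\<otimes>\<^bsub>F\<^esub>) w \<one>\<^bsub>F\<^esub>)) \<le> M * length w"
  using assms
proof (induction w)
  case Nil
  then show ?case using card_bad_one F.one_closed by simp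
next
  case (Cons s w)
  then have IH: "foldr (\<otimes>\<^bsub>F\<^esub>) w \<one>\<^bsub>F\<^esub> \<in> thompson_carrier"
    "card (bad (foldr (\<otimes>\<^bsub>F\<^esub>) w \<one>\<^bsub>F\<^esub>)) \<le> M * length w"
    by auto
  have s: "s \<in> thompson_carrier" "card (bad s) \<le> M" using Cons.prems by auto
  show ?case using card_bad_mult[OF s(1) IH(1)] F.m_closed[of s] s IH by simp
qed

subsection \<open>Trees of intervals\<close>

lemma lower_level_int:
  fixes x :: real
  assumes "x * 2 ^ m \<in> \<int>" "m \<le> n" shows "x * 2 ^ n \<in> \<int>"
proof -
  have "x * 2 ^ n = (x * 2 ^ m) * 2 ^ (n - m)" using assms(2) by (simp add: mult.assoc flip: power_add)
  also have "\<dots> \<in> \<int>" by (rule Ints_mult[OF assms(1) Ints_power[OF Ints_numeral]])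
  finally show ?thesis .
qed

lemma std_sub_half:
  assumes u: "u \<in> std" and w: "w \<in> std" and sub: "fst u \<le> fst w" "snd w \<le> snd u" and ne: "w \<noteq> u"
  shows "snd w \<le> mid u \<or> mid u \<le> fst w"
proof -
  obtain m n where m: "u \<in> dint m" and n: "w \<in> dint n" using u w by (auto simp: std_def)
  have eu: "snd u = fst u + 1 / 2 ^ m" and ew: "snd w = fst w + 1 / 2 ^ n"
    using m n by (auto simp: dint_def)
  have "m < n"
  proof (rule ccontr)
    assume "\<not> m < n"
    then have "(2::real) ^ n \<le> 2 ^ m" by (intro power_increasing) auto
    then have "(1::real) / 2 ^ m \<le> 1 / 2 ^ n" by (intro divide_left_mono) auto
    then have "fst w = fst u" "snd w = snd u" using eu ew sub by linarith+
    then show False using ne by (simp add: prod_eq_iff)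
  qed
  moreover have "mid u * 2 ^ Suc m \<in> \<int>" using rc_dint[OF m] unfolding dint_def by (simp del: power_Suc)
  ultimately have "mid u * 2 ^ n \<in> \<int>" using lower_level_int[of "mid u" "Suc m" n] by simp
  then show ?thesis using dint_side[OF n] by blast
qed

datatype tree = Tip | Fork tree tree

fun leaves :: "tree \<Rightarrow> ivl \<Rightarrow> ivl list" where
  "leaves Tip u = [u]"
| "leaves (Fork l r) u = leaves l (lc u) @ leaves r (rc u)"

fun nodes :: "tree \<Rightarrow> ivl \<Rightarrow> ivl list" where
  "nodes Tip u = []"
| "nodes (Fork l r) u = u # nodes l (lc u) @ nodes r (rc u)"

fun chain :: "real \<Rightarrow> ivl list \<Rightarrow> real \<Rightarrow> bool" where
  "chain p [] q \<longleftrightarrow> p = q"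
| "chain p (w # ws) q \<longleftrightarrow> fst w = p \<and> chain (snd w) ws q"

lemma chain_append: "chain p (ws @ ws') q \<longleftrightarrow> (\<exists>m. chain p ws m \<and> chain m ws' q)"
  by (induction ws arbitrary: p) auto

lemma chain_leaves: "chain (fst u) (leaves T u) (snd u)"
proof (induction T arbitrary: u)
  case (Fork l r)
  then show ?case using Fork.IH(1)[of "lc u"] Fork.IH(2)[of "rc u"] by (auto simp: chain_append)
qed simp

lemma leaves_std: "u \<in> std \<Longrightarrow> set (leaves T u) \<subseteq> std"
  by (induction T arbitrary: u) (simp_all add: std_lc std_rc)

lemma leaves_sub: "u \<in> std \<Longrightarrow> w \<in> set (leaves T u) \<Longrightarrow> fst u \<le> fst w \<and> snd w \<le> snd u"
proof (induction T arbitrary: u)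
  case (Fork l r)
  then show ?case using Fork.IH(1)[of "lc u"] Fork.IH(2)[of "rc u"] std_bounds[OF Fork.prems(1)]
    by (auto simp: std_lc std_rc)
qed simp

lemma leaves_cover: "u \<in> std \<Longrightarrow> t \<le> snd u \<Longrightarrow> \<exists>w\<in>set (leaves T u). t \<le> snd w"
proof (induction T arbitrary: u)
  case (Fork l r)
  have "\<exists>w\<in>set (leaves r (rc u)). t \<le> snd w"
    using Fork.prems by (intro Fork.IH(2)) (simp_all add: std_rc)
  then show ?case unfolding leaves.simps set_append by blast
qed simp

lemma node_std: "u \<in> std \<Longrightarrow> set (nodes T u) \<subseteq> std"
  by (induction T arbitrary: u) (simp_all add: std_lc std_rc)

lemma node_sub: "u \<in> std \<Longrightarrow> v \<in> set (nodes T u) \<Longrightarrow> fst u \<le> fst v \<and> snd v \<le> snd u"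
proof (induction T arbitrary: u)
  case (Fork l r)
  then show ?case using Fork.IH(1)[of "lc u"] Fork.IH(2)[of "rc u"] std_bounds[OF Fork.prems(1)]
    by (auto simp: std_lc std_rc)
qed simp

lemma distinct_nodes: "u \<in> std \<Longrightarrow> distinct (nodes T u)"
proof (induction T arbitrary: u)
  case (Fork l r)
  note b = std_bounds[OF Fork.prems]
  have l: "fst u \<le> fst v \<and> snd v \<le> mid u" if "v \<in> set (nodes l (lc u))" for v
    using node_sub[OF std_lc[OF Fork.prems] that] by simp
  have r: "mid u \<le> fst v \<and> snd v \<le> snd u" if "v \<in> set (nodes r (rc u))" for v
    using node_sub[OF std_rc[OF Fork.prems] that] by simp
  have "v \<notin> set (nodes r (rc u))" if v: "v \<in> set (nodes l (lc u))" for v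
    using l[OF v] r[of v] std_bounds(5)[of v] node_std[OF std_lc[OF Fork.prems]] v by fastforce
  moreover have "u \<notin> set (nodes l (lc u))" "u \<notin> set (nodes r (rc u))" using l[of u] r[of u] b by auto
  ultimately show ?case using Fork std_lc std_rc by auto
qed simp

lemma length_leaves: "length (leaves T u) = Suc (length (nodes T u))"
  by (induction T arbitrary: u) simp_all

lemma above_leaf_nodes:
  assumes "u \<in> std" "w \<in> set (leaves T u)" "v \<in> std" "fst v \<le> fst w" "snd w \<le> snd v" "v \<noteq> w"
    "fst u \<le> fst v" "snd v \<le> snd u"
  shows "v \<in> set (nodes T u)"
  using assms
proof (induction T arbitrary: u)
  case Tip
  then have "v = w" by (auto simp: prod_eq_iff)
  then show ?case using Tip by simp
next
  case (Fork l r)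
  note b = std_bounds[OF Fork.prems(1)]
  have w: "w \<in> std" using Fork.prems leaves_std by blast
  note bw = std_bounds[OF w]
  show ?case
  proof (cases "v = u")
    case False
    then consider "snd v \<le> mid u" | "mid u \<le> fst v"
      using std_sub_half[of u v] Fork.prems by blast
    then show ?thesis
    proof cases
      case 1
      have "w \<notin> set (leaves r (rc u))"
        using leaves_sub[OF std_rc[OF Fork.prems(1)], of w r] 1 Fork.prems bw by auto
      then show ?thesis using Fork.IH(1)[of "lc u"] Fork.prems 1 by (auto simp: std_lc)
    next
      case 2
      have "w \<notin> set (leaves l (lc u))"
        using leaves_sub[OF std_lc[OF Fork.prems(1)], of w l] 2 Fork.prems bw by auto
      then show ?thesis using Fork.IH(2)[of "rc u"] Fork.prems 2 by (auto simp: std_rc)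
    qed
  qed simp
qed

lemma first_leaf: "u \<in> std \<Longrightarrow> \<exists>w\<in>set (leaves T u). fst w = fst u"
proof (induction T arbitrary: u)
  case (Fork l r)
  then show ?case using Fork.IH(1)[of "lc u"] by (auto simp: std_lc)
qed simp

lemma node_above_leaf:
  "u \<in> std \<Longrightarrow> v \<in> set (nodes T u) \<Longrightarrow> \<exists>w\<in>set (leaves T u). fst w = fst v \<and> snd w < snd v"
proof (induction T arbitrary: u)
  case (Fork l r)
  then consider "v = u" | "v \<in> set (nodes l (lc u))" | "v \<in> set (nodes r (rc u))" by auto
  then show ?case
  proof cases
    case 1
    have "\<exists>w\<in>set (leaves l (lc u)). fst w = fst u"
      using first_leaf[OF std_lc[OF Fork.prems(1)], of l] by simp
    then obtain w where w: "w \<in> set (leaves l (lc u))" "fst w = fst u" by blast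
    have "snd w < snd v"
      using leaves_sub[OF std_lc[OF Fork.prems(1)] w(1)] std_bounds[OF Fork.prems(1)] 1 by simp
    then show ?thesis using w 1 by (intro bexI[of _ w]) simp_all
  next
    case 2
    then show ?thesis using Fork.IH(1)[of "lc u"] Fork.prems by (auto simp: std_lc)
  next
    case 3
    then show ?thesis using Fork.IH(2)[of "rc u"] Fork.prems by (auto simp: std_rc)
  qed
qed simp

lemma chain_split:
  assumes "chain p ws q" "\<forall>w\<in>set ws. snd w \<le> m \<or> m \<le> fst w" "p \<le> m" "m \<le> q"
    "\<forall>w\<in>set ws. fst w < snd w"
  shows "\<exists>ws1 ws2. ws = ws1 @ ws2 \<and> chain p ws1 m \<and> chain m ws2 q"
  using assms
proof (induction ws arbitrary: p)
  case Nil
  then show ?case by (intro exI[of _ "[]"]) auto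
next
  case (Cons w ws)
  show ?case
  proof (cases "p = m")
    case True
    then show ?thesis using Cons.prems by (intro exI[of _ "[]"] exI[of _ "w # ws"]) auto
  next
    case False
    then have "snd w \<le> m" using Cons.prems by auto
    then obtain ws1 ws2 where "ws = ws1 @ ws2" "chain (snd w) ws1 m" "chain m ws2 q"
      using Cons.IH[of "snd w"] Cons.prems by auto
    then show ?thesis using Cons.prems by (intro exI[of _ "w # ws1"] exI[of _ ws2]) auto
  qed
qed

lemma chain_sub:
  "chain p ws q \<Longrightarrow> \<forall>w\<in>set ws. fst w < snd w \<Longrightarrow> p \<le> q \<and> (\<forall>w\<in>set ws. p \<le> fst w \<and> snd w \<le> q)"
  by (induction ws arbitrary: p) force+

lemma tree_of_chain:
  assumes "u \<in> std" "set ws \<subseteq> std" "chain (fst u) ws (snd u)"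
  shows "\<exists>T. leaves T u = ws"
  using assms
proof (induction "length ws" arbitrary: ws u rule: less_induct)
  case less
  note b = std_bounds[OF less.prems(1)]
  have pos: "\<forall>w\<in>set ws. fst w < snd w" using less.prems(2) std_bounds by blast
  note sub = chain_sub[OF less.prems(3) pos]
  show ?case
  proof (cases "u \<in> set ws")
    case True
    obtain xs ys where ws: "ws = xs @ u # ys" using split_list[OF True] by blast
    obtain m where x: "chain (fst u) xs m" "m = fst u" and y: "chain (snd u) ys (snd u)"
      using less.prems(3) unfolding ws chain_append by auto
    have "xs = []"
    proof (cases xs)
      case (Cons x zs)
      then show ?thesis using x chain_sub[of "snd x" zs m] pos ws by auto
    qed simp
    moreover have "ys = []"
    proof (cases ys)
      case (Cons z zs)
      then show ?thesis using y chain_sub[of "snd z" zs "snd u"] pos ws by auto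
    qed simp
    ultimately show ?thesis using ws by (intro exI[of _ Tip]) simp
  next
    case False
    have "snd w \<le> mid u \<or> mid u \<le> fst w" if "w \<in> set ws" for w
      using sub less.prems(2) False that by (intro std_sub_half[OF less.prems(1)]) auto
    then have half: "\<forall>w\<in>set ws. snd w \<le> mid u \<or> mid u \<le> fst w" by blast
    obtain ws1 ws2 where ws: "ws = ws1 @ ws2" and c: "chain (fst u) ws1 (mid u)" "chain (mid u) ws2 (snd u)"
      using chain_split[OF less.prems(3) half less_imp_le[OF b(2)] less_imp_le[OF b(3)] pos] by blast
    have "ws1 \<noteq> []" "ws2 \<noteq> []" using c b by auto
    then have l: "length ws1 < length ws" "length ws2 < length ws" using ws by auto
    obtain T1 where "leaves T1 (lc u) = ws1"
      using less.hyps[OF l(1) std_lc[OF less.prems(1)]] c less.prems(2) ws by auto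
    moreover obtain T2 where "leaves T2 (rc u) = ws2"
      using less.hyps[OF l(2) std_rc[OF less.prems(1)]] c less.prems(2) ws by auto
    ultimately show ?thesis using ws by (intro exI[of _ "Fork T1 T2"]) simp
  qed
qed

lemma minimal_tree:
  assumes "deep Q"
  shows "\<exists>T. (\<forall>w\<in>set (leaves T (0, 1)). Q w) \<and> (\<forall>v\<in>set (nodes T (0, 1)). \<not> Q v)"
proof -
  obtain n where n: "\<forall>u\<in>dint n. Q u" using deep_level[OF assms] by blast
  show ?thesis
  proof (rule level_induct[where n=n and
        P="\<lambda>u. \<exists>T. (\<forall>w\<in>set (leaves T u). Q w) \<and> (\<forall>v\<in>set (nodes T u). \<not> Q v)"])
    fix u assume "u \<in> dint n"
    then show "\<exists>T. (\<forall>w\<in>set (leaves T u). Q w) \<and> (\<forall>v\<in>set (nodes T u). \<not> Q v)"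
      using n by (intro exI[of _ Tip]) simp
  next
    fix u
    assume "\<exists>T. (\<forall>w\<in>set (leaves T (lc u)). Q w) \<and> (\<forall>v\<in>set (nodes T (lc u)). \<not> Q v)"
      and "\<exists>T. (\<forall>w\<in>set (leaves T (rc u)). Q w) \<and> (\<forall>v\<in>set (nodes T (rc u)). \<not> Q v)"
    then obtain l r where lr: "\<forall>w\<in>set (leaves l (lc u)). Q w" "\<forall>v\<in>set (nodes l (lc u)). \<not> Q v"
      "\<forall>w\<in>set (leaves r (rc u)). Q w" "\<forall>v\<in>set (nodes r (rc u)). \<not> Q v" by blast
    show "\<exists>T. (\<forall>w\<in>set (leaves T u). Q w) \<and> (\<forall>v\<in>set (nodes T u). \<not> Q v)"
    proof (cases "Q u")
      case True
      then show ?thesis by (intro exI[of _ Tip]) simp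
    next
      case False
      then show ?thesis using lr by (intro exI[of _ "Fork l r"]) auto
    qed
  qed
qed

subsection \<open>Classes of intervals and orbits of points\<close>

definition eqv :: "(real \<Rightarrow> real) set \<Rightarrow> ivl \<Rightarrow> ivl \<Rightarrow> bool" where
  "eqv K u v \<longleftrightarrow> u \<in> std \<and> (\<exists>k\<in>K. good k u \<and> img k u = v)"

locale glue_closed = subgroup K F for K +
  assumes glue_mem:
    "\<lbrakk>f \<in> K; g \<in> K; c \<in> dyadic; c \<in> {0..1}; f c = g c\<rbrakk> \<Longrightarrow> glue c f g \<in> K"
begin

lemma in_F: "k \<in> K \<Longrightarrow> k \<in> thompson_carrier"
  using subset by auto

lemma eqv_std: "eqv K u v \<Longrightarrow> u \<in> std" "eqv K u v \<Longrightarrow> v \<in> std"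
  by (auto simp: eqv_def img_std)

lemma eqv_refl: "u \<in> std \<Longrightarrow> eqv K u u"
  using good_one img_one one_closed unfolding eqv_def by blast

lemma eqv_sym: assumes "eqv K u v" shows "eqv K v u"
proof -
  obtain k where k: "k \<in> K" "good k u" "img k u = v" "u \<in> std" using assms by (auto simp: eqv_def)
  then show ?thesis using good_inv_F[OF in_F[OF k(1)] k(4,2)] m_inv_closed[OF k(1)] img_std[OF k(2)]
    unfolding eqv_def by blast
qed

lemma eqv_trans: assumes "eqv K u v" "eqv K v w" shows "eqv K u w"
proof -
  obtain k where k: "k \<in> K" "good k u" "img k u = v" "u \<in> std" using assms(1) by (auto simp: eqv_def)
  obtain l where l: "l \<in> K" "good l v" "img l v = w" using assms(2) by (auto simp: eqv_def)
  have "good (l \<otimes>\<^bsub>F\<^esub> k) u"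
    using good_mult[OF in_F[OF l(1)] in_F[OF k(1)] k(4,2)] l k by simp
  moreover have "img (l \<otimes>\<^bsub>F\<^esub> k) u = w"
    using img_mult[OF in_F[OF l(1)] in_F[OF k(1)] k(4)] l k by simp
  ultimately show ?thesis using m_closed[OF l(1) k(1)] k(4) unfolding eqv_def by blast
qed

lemma eqv_lc: assumes "eqv K u v" shows "eqv K (lc u) (lc v)"
proof -
  obtain k where "k \<in> K" "good k u" "img k u = v" "u \<in> std" using assms by (auto simp: eqv_def)
  then show ?thesis using img_lc[of u k] good_lc[of u k] std_lc[of u] unfolding eqv_def by blast
qed

lemma eqv_rc: assumes "eqv K u v" shows "eqv K (rc u) (rc v)"
proof -
  obtain k where "k \<in> K" "good k u" "img k u = v" "u \<in> std" using assms by (auto simp: eqv_def)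
  then show ?thesis using img_rc[of u k] good_rc[of u k] std_rc[of u] unfolding eqv_def by blast
qed

definition rep :: "ivl \<Rightarrow> ivl" where
  "rep u = (SOME v. eqv K u v)"

definition orbit_rep :: "real \<Rightarrow> real" where
  "orbit_rep a = (SOME b. \<exists>k\<in>K. k a = b)"

definition orbit_map :: "real \<Rightarrow> real \<Rightarrow> real" where
  "orbit_map a = (SOME k. k \<in> K \<and> k a = orbit_rep a)"

lemma eqv_rep: "u \<in> std \<Longrightarrow> eqv K u (rep u)"
  unfolding rep_def by (rule someI) (rule eqv_refl)

lemma rep_std: "u \<in> std \<Longrightarrow> rep u \<in> std"
  using eqv_rep eqv_std by blast

lemma rep_eq: assumes "eqv K u v" shows "rep u = rep v"
proof -
  have "eqv K u = eqv K v" using assms eqv_trans eqv_sym by blast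
  then show ?thesis by (simp add: rep_def)
qed

lemma orbit_rep_eq: assumes k: "k \<in> K" and a: "a \<in> {0..1}" shows "orbit_rep (k a) = orbit_rep a"
proof -
  have "(\<exists>l\<in>K. l (k a) = b) \<longleftrightarrow> (\<exists>l\<in>K. l a = b)" for b
  proof
    assume "\<exists>l\<in>K. l (k a) = b"
    then obtain l where l: "l \<in> K" "l (k a) = b" by blast
    then show "\<exists>l\<in>K. l a = b" using F_mult[OF in_F[OF l(1)] in_F[OF k] a] m_closed[OF l(1) k] by metis
  next
    assume "\<exists>l\<in>K. l a = b"
    then obtain l where l: "l \<in> K" "l a = b" by blast
    have i: "inv\<^bsub>F\<^esub> k \<in> K" using m_inv_closed[OF k] .
    have "(l \<otimes>\<^bsub>F\<^esub> inv\<^bsub>F\<^esub> k) (k a) = b"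
      using F_mult[OF in_F[OF l(1)] in_F[OF i] F_range[OF in_F[OF k] a]] F_inv(1)[OF in_F[OF k] a] l by simp
    then show "\<exists>l\<in>K. l (k a) = b" using m_closed[OF l(1) i] by blast
  qed
  then show ?thesis by (simp add: orbit_rep_def)
qed

lemma orbit_map: "orbit_map a \<in> K" "orbit_map a a = orbit_rep a"
proof -
  have "\<exists>k\<in>K. k a = orbit_rep a" unfolding orbit_rep_def by (rule someI[of _ "\<one>\<^bsub>F\<^esub> a"]) (use one_closed in blast)
  then have "\<exists>k. k \<in> K \<and> k a = orbit_rep a" by blast
  from someI_ex[OF this] show "orbit_map a \<in> K" "orbit_map a a = orbit_rep a" by (auto simp: orbit_map_def)
qed

text \<open>
  The maps \<open>left_map u\<close> and \<open>right_map u\<close> place the representative of the class of \<open>u\<close> so that its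
  left, respectively right, end point is an orbit representative. With the pointer at an end point
  of \<open>u\<close>, the subdivision is drawn by one of these two maps on \<open>u\<close>, and \<open>shift u\<close> moves the pointer
  from the left to the right of \<open>u\<close>.
\<close>

definition left_map :: "ivl \<Rightarrow> real \<Rightarrow> real" where
  "left_map u = orbit_map (fst (rep u))"

definition right_map :: "ivl \<Rightarrow> real \<Rightarrow> real" where
  "right_map u = orbit_map (snd (rep u))"

definition shift :: "ivl \<Rightarrow> real \<Rightarrow> real" where
  "shift u = right_map u \<otimes>\<^bsub>F\<^esub> inv\<^bsub>F\<^esub> (left_map u)"

definition to_rep :: "ivl \<Rightarrow> real \<Rightarrow> real" where
  "to_rep u = lin u (rep u)"

lemma maps_in_K: "left_map u \<in> K" "right_map u \<in> K" "shift u \<in> K"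
  by (simp_all add: left_map_def right_map_def shift_def orbit_map m_inv_closed m_closed)

lemmas maps_in_F = maps_in_K[THEN in_F]

lemma to_repE:
  assumes "u \<in> std"
  obtains k where "k \<in> K" "\<And>t. t \<in> {fst u..snd u} \<Longrightarrow> k t = to_rep u t"
  using eqv_rep[OF assms] unfolding eqv_def to_rep_def by (metis goodD)

lemma to_rep_ends:
  assumes "u \<in> std"
  shows "to_rep u (fst u) = fst (rep u)" "to_rep u (snd u) = snd (rep u)"
  using std_bounds[OF assms] by (simp_all add: to_rep_def)

lemma to_rep_range:
  assumes u: "u \<in> std" and t: "t \<in> {fst u..snd u}"
  shows "to_rep u t \<in> {fst (rep u)..snd (rep u)}" "to_rep u t \<in> {0..1}"
proof -
  show "to_rep u t \<in> {fst (rep u)..snd (rep u)}" unfolding to_rep_def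
    using lin_range[OF std_bounds(5)[OF u] std_bounds(5)[OF rep_std[OF u]] t] .
  then show "to_rep u t \<in> {0..1}" by (rule std_in[OF rep_std[OF u]])
qed

lemma orbit_rep_rep:
  assumes u: "u \<in> std"
  shows "orbit_rep (fst (rep u)) = orbit_rep (fst u)" "orbit_rep (snd (rep u)) = orbit_rep (snd u)"
proof -
  obtain k where k: "k \<in> K" "\<And>t. t \<in> {fst u..snd u} \<Longrightarrow> k t = to_rep u t" using to_repE[OF u] by blast
  note b = std_bounds[OF u]
  show "orbit_rep (fst (rep u)) = orbit_rep (fst u)" "orbit_rep (snd (rep u)) = orbit_rep (snd u)"
    using k(2)[of "fst u"] k(2)[of "snd u"] orbit_rep_eq[OF k(1), of "fst u"] orbit_rep_eq[OF k(1), of "snd u"] b to_rep_ends[OF u]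
    by auto
qed

lemma left_map_fst: "u \<in> std \<Longrightarrow> left_map u (fst (rep u)) = orbit_rep (fst u)"
  by (simp add: left_map_def orbit_map orbit_rep_rep)

lemma right_map_snd: "u \<in> std \<Longrightarrow> right_map u (snd (rep u)) = orbit_rep (snd u)"
  by (simp add: right_map_def orbit_map orbit_rep_rep)

lemma shift_left_map: "t \<in> {0..1} \<Longrightarrow> shift u (left_map u t) = right_map u t"
  unfolding shift_def
  using F_mult[OF maps_in_F(2) in_F[OF m_inv_closed[OF maps_in_K(1)]] F_range[OF maps_in_F(1)]]
    F_inv(1)[OF maps_in_F(1)] by simp

lemma shift_end: "u \<in> std \<Longrightarrow> shift u (left_map u (snd (rep u))) = orbit_rep (snd u)"
  using shift_left_map[of "snd (rep u)" u] right_map_snd[of u] std_bounds[OF rep_std[of u]] by simp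

text \<open>
  The letter that expands \<open>u\<close> into its two halves with the pointer at the left end point. The last
  two clauses are stated after applying \<open>shift\<close> because the right half and everything beyond \<open>u\<close>
  are drawn correctly only once the pointer has moved there.
\<close>

definition splits :: "ivl \<Rightarrow> (real \<Rightarrow> real) \<Rightarrow> bool" where
  "splits u e \<longleftrightarrow> e \<in> K \<and> (\<forall>t\<in>{0..orbit_rep (fst u)}. e t = t) \<and>
     (\<forall>t\<in>{fst u..mid u}. e (left_map u (to_rep u t)) = left_map (lc u) (to_rep (lc u) t)) \<and>
     (\<forall>t\<in>{mid u..snd u}. shift (lc u) (e (left_map u (to_rep u t))) = left_map (rc u) (to_rep (rc u) t)) \<and>
     (\<forall>t\<in>{left_map u (snd (rep u))..1}. shift (rc u) (shift (lc u) (e t)) = shift u t)"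

lemma std_dyadic:
  assumes "u \<in> std" shows "fst u \<in> dyadic" "mid u \<in> dyadic" "snd u \<in> dyadic"
proof -
  have fst: "fst u \<in> dyadic" if "u \<in> std" for u using that by (auto simp: std_def dint_def intro: dyadicI)
  show "fst u \<in> dyadic" "mid u \<in> dyadic" using fst[OF assms] fst[OF std_rc[OF assms]] by simp_all
  obtain n where "u \<in> dint n" using assms by (auto simp: std_def)
  then have "snd u * 2 ^ n = fst u * 2 ^ n + 1" "fst u * 2 ^ n \<in> \<int>" by (auto simp: dint_def distrib_right)
  then show "snd u \<in> dyadic" by (intro dyadicI[of _ n]) simp
qed

lemma orbit_rep_range: "a \<in> {0..1} \<Longrightarrow> orbit_rep a \<in> {0..1}"
  using F_range[OF in_F[OF orbit_map(1)[of a]]] orbit_map(2)[of a] by metis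

lemma ex_splits:
  assumes u: "u \<in> std" shows "\<exists>e. splits u e"
proof -
  note b = std_bounds[OF u] and l = std_lc[OF u] and r = std_rc[OF u] and dy = std_dyadic[OF u]
  obtain k where k: "k \<in> K" "\<And>t. t \<in> {fst u..snd u} \<Longrightarrow> k t = to_rep u t" using to_repE[OF u] by blast
  obtain kl where kl: "kl \<in> K" "\<And>t. t \<in> {fst u..mid u} \<Longrightarrow> kl t = to_rep (lc u) t" using to_repE[OF l] by auto
  obtain kr where kr: "kr \<in> K" "\<And>t. t \<in> {mid u..snd u} \<Longrightarrow> kr t = to_rep (rc u) t" using to_repE[OF r] by auto
  define P where "P = left_map u \<otimes>\<^bsub>F\<^esub> k"
  define L where "L = left_map (lc u) \<otimes>\<^bsub>F\<^esub> kl"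
  define R0 where "R0 = left_map (rc u) \<otimes>\<^bsub>F\<^esub> kr"
  define R where "R = inv\<^bsub>F\<^esub> (shift (lc u)) \<otimes>\<^bsub>F\<^esub> R0"
  define Q0 where "Q0 = inv\<^bsub>F\<^esub> (shift (rc u)) \<otimes>\<^bsub>F\<^esub> (shift u \<otimes>\<^bsub>F\<^esub> P)"
  define Q where "Q = inv\<^bsub>F\<^esub> (shift (lc u)) \<otimes>\<^bsub>F\<^esub> Q0"
  have inK: "P \<in> K" "L \<in> K" "R0 \<in> K" "R \<in> K" "Q0 \<in> K" "Q \<in> K"
    using k(1) kl(1) kr(1) unfolding P_def L_def R0_def R_def Q0_def Q_def
    by (simp_all add: m_closed m_inv_closed maps_in_K)
  note inF = inK[THEN in_F] k(1)[THEN in_F] kl(1)[THEN in_F] kr(1)[THEN in_F]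
  have rng: "x \<in> K \<Longrightarrow> t \<in> {0..1} \<Longrightarrow> x t \<in> {0..1}" for x t using F_range in_F by blast
  have mlt: "x \<in> K \<Longrightarrow> y \<in> K \<Longrightarrow> t \<in> {0..1} \<Longrightarrow> (x \<otimes>\<^bsub>F\<^esub> y) t = x (y t)" for x y t
    using F_mult in_F by blast
  have ivv: "x \<in> K \<Longrightarrow> t \<in> {0..1} \<Longrightarrow> x ((inv\<^bsub>F\<^esub> x) t) = t" for x t using F_inv(2) in_F by blast
  have ivl: "x \<in> K \<Longrightarrow> t \<in> {0..1} \<Longrightarrow> (inv\<^bsub>F\<^esub> x) (x t) = t" for x t using F_inv(1) in_F by blast
  have Pe: "P t = left_map u (to_rep u t)" if "t \<in> {fst u..snd u}" for t
    using that std_in[OF u that] k unfolding P_def by (simp add: mlt maps_in_K)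
  have Le: "L t = left_map (lc u) (to_rep (lc u) t)" if "t \<in> {fst u..mid u}" for t
    using that std_in[OF l] kl unfolding L_def by (simp add: mlt maps_in_K)
  have R0e: "R0 t = left_map (rc u) (to_rep (rc u) t)" if "t \<in> {mid u..snd u}" for t
    using that std_in[OF r] kr unfolding R0_def by (simp add: mlt maps_in_K)
  have Re: "R t = (inv\<^bsub>F\<^esub> (shift (lc u))) (R0 t)" if "t \<in> {0..1}" for t
    unfolding R_def using that by (intro mlt m_inv_closed maps_in_K inK)
  have Rs: "shift (lc u) (R t) = R0 t" if "t \<in> {0..1}" for t
    unfolding Re[OF that] by (rule ivv[OF maps_in_K(3) rng[OF inK(3) that]])
  have Q0e: "Q0 t = (inv\<^bsub>F\<^esub> (shift (rc u))) (shift u (P t))" if t: "t \<in> {0..1}" for t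
    unfolding Q0_def
    using mlt[OF m_inv_closed[OF maps_in_K(3)] m_closed[OF maps_in_K(3) inK(1)] t] mlt[OF maps_in_K(3) inK(1) t]
    by simp
  have Q0s: "shift (rc u) (Q0 t) = shift u (P t)" if t: "t \<in> {0..1}" for t
    unfolding Q0e[OF t] by (rule ivv[OF maps_in_K(3) rng[OF maps_in_K(3) rng[OF inK(1) t]]])
  have Qe: "Q t = (inv\<^bsub>F\<^esub> (shift (lc u))) (Q0 t)" if "t \<in> {0..1}" for t
    unfolding Q_def using that by (intro mlt m_inv_closed maps_in_K inK)
  have Qs: "shift (lc u) (Q t) = Q0 t" if "t \<in> {0..1}" for t
    unfolding Qe[OF that] by (rule ivv[OF maps_in_K(3) rng[OF inK(5) that]])
  have u01: "fst u \<in> {0..1}" "mid u \<in> {0..1}" "snd u \<in> {0..1}" using b by auto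
  have rep01: "snd (rep v) \<in> {0..1}" "fst (rep v) \<in> {0..1}" if "v \<in> std" for v
    using std_bounds[OF rep_std[OF that]] by auto
  have PL: "P (fst u) = L (fst u)"
    using Pe[of "fst u"] Le[of "fst u"] b to_rep_ends[OF u] to_rep_ends[OF l]
    by (simp add: left_map_fst[OF u] left_map_fst[OF l])
  have LR: "L (mid u) = R (mid u)"
  proof -
    have "shift (lc u) (L (mid u)) = orbit_rep (mid u)"
      using Le[of "mid u"] b to_rep_ends(2)[OF l] shift_end[OF l] by simp
    also have "\<dots> = R0 (mid u)"
      using R0e[of "mid u"] b to_rep_ends(1)[OF r] left_map_fst[OF r] by simp
    also have "\<dots> = shift (lc u) (R (mid u))" using Rs[OF u01(2)] by simp
    finally show ?thesis
      using F_inj[OF maps_in_F(3) rng[OF inK(2) u01(2)] rng[OF inK(4) u01(2)]] by blast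
  qed
  have RQ0: "R0 (snd u) = Q0 (snd u)"
  proof -
    have "shift (rc u) (R0 (snd u)) = orbit_rep (snd u)"
      using R0e[of "snd u"] b to_rep_ends(2)[OF r] shift_end[OF r] by simp
    also have "\<dots> = shift u (P (snd u))"
      using Pe[of "snd u"] b to_rep_ends(2)[OF u] shift_end[OF u] by simp
    also have "\<dots> = shift (rc u) (Q0 (snd u))" using Q0s[OF u01(3)] by simp
    finally show ?thesis
      using F_inj[OF maps_in_F(3) rng[OF inK(3) u01(3)] rng[OF inK(5) u01(3)]] by blast
  qed
  have RQ: "R (snd u) = Q (snd u)" using RQ0 Re[OF u01(3)] Qe[OF u01(3)] by simp
  define G1 where "G1 = glue (snd u) R Q"
  define G2 where "G2 = glue (mid u) L G1"
  define G where "G = glue (fst u) P G2"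
  have G1K: "G1 \<in> K" unfolding G1_def by (rule glue_mem) (use inK dy u01 RQ in auto)
  have LG: "L (mid u) = G1 (mid u)" using LR b by (simp add: G1_def glue_def)
  have G2K: "G2 \<in> K" unfolding G2_def by (rule glue_mem) (use inK dy u01 LG G1K in auto)
  have PG: "P (fst u) = G2 (fst u)" using PL b by (simp add: G2_def glue_def)
  have GK: "G \<in> K" unfolding G_def by (rule glue_mem) (use inK dy u01 PG G2K in auto)
  have GP: "G t = P t" if "t \<in> {0..fst u}" for t
    unfolding G_def using that b by (intro glue_left) auto
  have GL: "G t = L t" if "t \<in> {fst u..mid u}" for t
  proof -
    have "G t = G2 t" unfolding G_def using that b PG by (intro glue_right) auto
    also have "\<dots> = L t" unfolding G2_def using that b by (intro glue_left) auto
    finally show ?thesis .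
  qed
  have GG1: "G t = G1 t" if "t \<in> {mid u..1}" for t
  proof -
    have "G t = G2 t" unfolding G_def using that b PG by (intro glue_right) auto
    also have "\<dots> = G1 t" unfolding G2_def using that b LG by (intro glue_right) auto
    finally show ?thesis .
  qed
  have GR: "G t = R t" if "t \<in> {mid u..snd u}" for t
  proof -
    have "G t = G1 t" using that b by (intro GG1) auto
    also have "\<dots> = R t" unfolding G1_def using that b by (intro glue_left) auto
    finally show ?thesis .
  qed
  have GQ: "G t = Q t" if "t \<in> {snd u..1}" for t
  proof -
    have "G t = G1 t" using that b by (intro GG1) auto
    also have "\<dots> = Q t" unfolding G1_def using that b RQ by (intro glue_right) auto
    finally show ?thesis .
  qed
  let ?Pi = "inv\<^bsub>F\<^esub> P"
  let ?e = "G \<otimes>\<^bsub>F\<^esub> ?Pi"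
  have PiK: "?Pi \<in> K" by (rule m_inv_closed[OF inK(1)])
  have e: "?e t = G (?Pi t)" if "t \<in> {0..1}" for t by (rule mlt[OF GK PiK that])
  have eP: "?e (P t) = G t" if "t \<in> {0..1}" for t
    using e[OF rng[OF inK(1) that]] ivl[OF inK(1) that] by simp
  have pre: "\<exists>s\<in>{a..b}. t = P s" if "t \<in> {P a..P b}" "a \<in> {0..1}" "b \<in> {0..1}" for t a b
  proof -
    have t01: "t \<in> {0..1}" using that rng[OF inK(1) that(2)] rng[OF inK(1) that(3)] by auto
    let ?s = "?Pi t"
    have s: "?s \<in> {0..1}" "P ?s = t" using rng[OF PiK t01] ivv[OF inK(1) t01] by auto
    have "a \<le> ?s" using F_less[OF inF(1), of ?s a] that s by force
    moreover have "?s \<le> b" using F_less[OF inF(1), of b ?s] that s by force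
    ultimately show ?thesis using s by (intro bexI[of _ ?s]) auto
  qed
  have P0: "P 0 = 0" "P 1 = 1" using F_ends[OF inF(1)] by auto
  have Pf: "P (fst u) = orbit_rep (fst u)"
    using Pe[of "fst u"] b to_rep_ends[OF u] left_map_fst[OF u] by simp
  have Ps: "P (snd u) = left_map u (snd (rep u))"
    using Pe[of "snd u"] b to_rep_ends[OF u] by simp
  have "splits u ?e"
    unfolding splits_def
  proof (intro conjI ballI)
    show "?e \<in> K" by (rule m_closed[OF GK PiK])
  next
    fix t assume "t \<in> {0..orbit_rep (fst u)}"
    then have "t \<in> {P 0..P (fst u)}" unfolding P0 Pf .
    then obtain s where s: "s \<in> {0..fst u}" "t = P s" using pre u01 by (metis atLeastAtMost_iff order_refl zero_le_one)
    then have "s \<in> {0..1}" using b by auto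
    then show "?e t = t" using eP GP s by simp
  next
    fix t assume t: "t \<in> {fst u..mid u}"
    then have "t \<in> {0..1}" "t \<in> {fst u..snd u}" using b by auto
    then show "?e (left_map u (to_rep u t)) = left_map (lc u) (to_rep (lc u) t)"
      using eP GL[OF t] Pe Le[OF t] by metis
  next
    fix t assume t: "t \<in> {mid u..snd u}"
    then have t01: "t \<in> {0..1}" "t \<in> {fst u..snd u}" using b by auto
    then have "?e (left_map u (to_rep u t)) = R t" using eP GR[OF t] Pe by metis
    then show "shift (lc u) (?e (left_map u (to_rep u t))) = left_map (rc u) (to_rep (rc u) t)"
      using Rs[OF t01(1)] R0e[OF t] by metis
  next
    fix t assume "t \<in> {left_map u (snd (rep u))..1}"
    then have "t \<in> {P (snd u)..P 1}" unfolding P0 Ps .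
    then obtain s where s: "s \<in> {snd u..1}" "t = P s" using pre u01 by (metis atLeastAtMost_iff order_refl zero_le_one)
    then have s01: "s \<in> {0..1}" using b by auto
    then have "?e t = Q s" using eP[OF s01] GQ[OF s(1)] s by simp
    then show "shift (rc u) (shift (lc u) (?e t)) = shift u t"
      using Qs[OF s01] Q0s[OF s01] s by simp
  qed
  then show ?thesis by blast
qed

text \<open>Choosing the map for \<open>rep u\<close> makes \<open>split_map u\<close> depend only on the class of \<open>u\<close>.\<close>

definition split_map :: "ivl \<Rightarrow> real \<Rightarrow> real" where
  "split_map u = (SOME e. splits (rep u) e)"

lemma to_rep_lin: "eqv K u v \<Longrightarrow> to_rep v (lin u v t) = to_rep u t"
  using rep_eq std_bounds(5)[OF eqv_std(1)] std_bounds(5)[OF eqv_std(2)]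
  by (simp add: to_rep_def lin_lin)

lemma splits_eqv:
  assumes uv: "eqv K u v" and e: "splits v e" shows "splits u e"
proof -
  note u = eqv_std(1)[OF uv] and v = eqv_std(2)[OF uv]
  note bu = std_bounds[OF u] and bv = std_bounds[OF v]
  have same: "left_map u = left_map v" "left_map (lc u) = left_map (lc v)" "left_map (rc u) = left_map (rc v)"
    "shift u = shift v" "shift (lc u) = shift (lc v)" "shift (rc u) = shift (rc v)" "rep u = rep v"
    using rep_eq[OF uv] rep_eq[OF eqv_lc[OF uv]] rep_eq[OF eqv_rc[OF uv]]
    by (simp_all add: left_map_def shift_def right_map_def)
  have orbit_rep: "orbit_rep (fst u) = orbit_rep (fst v)"
    using orbit_rep_rep(1)[OF u] orbit_rep_rep(1)[OF v] same by simp
  have tr: "to_rep v (lin u v t) = to_rep u t" for t using to_rep_lin[OF uv] .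
  have trl: "to_rep (lc v) (lin u v t) = to_rep (lc u) t" for t
    using to_rep_lin[OF eqv_lc[OF uv]] lin_lc[OF bu(5)] by metis
  have trr: "to_rep (rc v) (lin u v t) = to_rep (rc u) t" for t
    using to_rep_lin[OF eqv_rc[OF uv]] lin_rc[OF bu(5)] by metis
  have rl: "lin u v t \<in> {fst v..mid v}" if "t \<in> {fst u..mid u}" for t
    using lin_range[of "lc u" "lc v" t] bu bv that lin_lc[OF bu(5)] by simp
  have rr: "lin u v t \<in> {mid v..snd v}" if "t \<in> {mid u..snd u}" for t
    using lin_range[of "rc u" "rc v" t] bu bv that lin_rc[OF bu(5)] by simp
  show ?thesis unfolding splits_def same orbit_rep
  proof (intro conjI ballI)
    fix t assume "t \<in> {fst u..mid u}"
    then show "e (left_map v (to_rep u t)) = left_map (lc v) (to_rep (lc u) t)"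
      using e rl unfolding splits_def by (metis tr trl)
  next
    fix t assume "t \<in> {mid u..snd u}"
    then show "shift (lc v) (e (left_map v (to_rep u t))) = left_map (rc v) (to_rep (rc u) t)"
      using e rr unfolding splits_def by (metis tr trr)
  qed (use e in \<open>auto simp: splits_def\<close>)
qed

lemma splits_split_map: assumes "u \<in> std" shows "splits u (split_map u)"
proof -
  have "splits (rep u) (split_map u)"
    unfolding split_map_def using someI_ex[OF ex_splits[OF rep_std[OF assms]]] .
  then show ?thesis by (rule splits_eqv[OF eqv_rep[OF assms]])
qed

end

subsection \<open>Word products\<close>

lemma F_word_products_mult:
  assumes "S \<subseteq> thompson_carrier" "f \<in> word_products F S i" "g \<in> word_products F S j"
  shows "f \<otimes>\<^bsub>F\<^esub> g \<in> word_products F S (i + j)"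
proof -
  let ?L = "S \<union> m_inv F ` S"
  have L: "?L \<subseteq> carrier F" using assms(1) F.inv_closed by auto
  have cl: "set w \<subseteq> ?L \<Longrightarrow> foldr (\<otimes>\<^bsub>F\<^esub>) w \<one>\<^bsub>F\<^esub> \<in> carrier F" for w
    by (induction w) (use L in \<open>auto intro!: F.m_closed simp del: carrier_F\<close>)
  obtain v where v: "f = foldr (\<otimes>\<^bsub>F\<^esub>) v \<one>\<^bsub>F\<^esub>" "length v = i" "set v \<subseteq> ?L"
    using assms(2) by (auto simp: word_products_def)
  obtain w where w: "g = foldr (\<otimes>\<^bsub>F\<^esub>) w \<one>\<^bsub>F\<^esub>" "length w = j" "set w \<subseteq> ?L"
    using assms(3) by (auto simp: word_products_def)
  have "foldr (\<otimes>\<^bsub>F\<^esub>) (v' @ w) \<one>\<^bsub>F\<^esub> = foldr (\<otimes>\<^bsub>F\<^esub>) v' \<one>\<^bsub>F\<^esub> \<otimes>\<^bsub>F\<^esub> g" if "set v' \<subseteq> ?L" for v'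
    using that
  proof (induction v')
    case Nil
    then show ?case using cl[OF w(3)] w(1) by (simp del: carrier_F)
  next
    case (Cons a v')
    then have "a \<in> carrier F" "foldr (\<otimes>\<^bsub>F\<^esub>) v' \<one>\<^bsub>F\<^esub> \<in> carrier F" "g \<in> carrier F"
      using cl[OF w(3)] cl[of v'] L w(1) by auto
    then show ?case using Cons by (simp add: F.m_assoc del: carrier_F)
  qed
  from this[OF v(3)] show ?thesis unfolding word_products_def using v w
    by (intro CollectI exI[of _ "v @ w"]) auto
qed

lemma F_word_products_one: "\<one>\<^bsub>F\<^esub> \<in> word_products F S 0"
  by (simp add: word_products_def)

lemma F_word_products_single:
  assumes "S \<subseteq> thompson_carrier" "s \<in> S \<union> m_inv F ` S" shows "s \<in> word_products F S 1"
proof -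
  have "s \<in> carrier F" using assms F.inv_closed by auto
  then show ?thesis unfolding word_products_def using assms(2)
    by (intro CollectI exI[of _ "[s]"]) (simp del: carrier_F)
qed

lemma F_word_products_carrier:
  assumes "S \<subseteq> thompson_carrier" "f \<in> word_products F S n" shows "f \<in> thompson_carrier"
proof -
  have L: "S \<union> m_inv F ` S \<subseteq> carrier F" using assms(1) F.inv_closed by auto
  have "set w \<subseteq> S \<union> m_inv F ` S \<Longrightarrow> foldr (\<otimes>\<^bsub>F\<^esub>) w \<one>\<^bsub>F\<^esub> \<in> carrier F" for w
    by (induction w) (use L in \<open>auto intro!: F.m_closed simp del: carrier_F\<close>)
  then show ?thesis using assms(2) by (auto simp: word_products_def)
qed

lemma F_word_products_inv:
  assumes S: "S \<subseteq> thompson_carrier" and f: "f \<in> word_products F S n"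
  shows "inv\<^bsub>F\<^esub> f \<in> word_products F S n"
proof -
  let ?L = "S \<union> m_inv F ` S"
  have L: "?L \<subseteq> carrier F" using S F.inv_closed by auto
  obtain v where v: "f = foldr (\<otimes>\<^bsub>F\<^esub>) v \<one>\<^bsub>F\<^esub>" "length v = n" "set v \<subseteq> ?L"
    using f by (auto simp: word_products_def)
  have inv1: "inv\<^bsub>F\<^esub> s \<in> word_products F S 1" if "s \<in> ?L" for s
  proof (rule F_word_products_single[OF S])
    show "inv\<^bsub>F\<^esub> s \<in> ?L" using that S F.inv_inv by auto
  qed
  have "inv\<^bsub>F\<^esub> (foldr (\<otimes>\<^bsub>F\<^esub>) w \<one>\<^bsub>F\<^esub>) \<in> word_products F S (length w)" if "set w \<subseteq> ?L" for w
    using that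
  proof (induction w)
    case Nil
    then show ?case using F_word_products_one by simp
  next
    case (Cons a w)
    have "foldr (\<otimes>\<^bsub>F\<^esub>) w \<one>\<^bsub>F\<^esub> \<in> word_products F S (length w)"
      using Cons.prems by (auto simp: word_products_def)
    then have w: "foldr (\<otimes>\<^bsub>F\<^esub>) w \<one>\<^bsub>F\<^esub> \<in> carrier F" using F_word_products_carrier[OF S] by simp
    have a: "a \<in> ?L" "a \<in> carrier F" using Cons.prems L by auto
    have "inv\<^bsub>F\<^esub> (foldr (\<otimes>\<^bsub>F\<^esub>) (a # w) \<one>\<^bsub>F\<^esub>) = inv\<^bsub>F\<^esub> (foldr (\<otimes>\<^bsub>F\<^esub>) w \<one>\<^bsub>F\<^esub>) \<otimes>\<^bsub>F\<^esub> inv\<^bsub>F\<^esub> a"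
      using F.inv_mult_group[OF a(2) w] by simp
    then show ?case using F_word_products_mult[OF S Cons.IH inv1[OF a(1)]] Cons.prems by simp
  qed
  then show ?thesis using v by blast
qed

subsection \<open>Elements of a closed subgroup as words\<close>

context glue_closed
begin

fun tree_map :: "tree \<Rightarrow> ivl \<Rightarrow> real \<Rightarrow> real" where
  "tree_map Tip u = shift u"
| "tree_map (Fork l r) u = tree_map r (rc u) \<otimes>\<^bsub>F\<^esub> (tree_map l (lc u) \<otimes>\<^bsub>F\<^esub> split_map u)"

fun shifts :: "ivl list \<Rightarrow> real \<Rightarrow> real" where
  "shifts [] t = t"
| "shifts (w # ws) t = shifts ws (shift w t)"

text \<open>The drawing of a sequence of leaves with the pointer at its right end.\<close>

fun leaf_map :: "ivl list \<Rightarrow> real \<Rightarrow> real" where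
  "leaf_map [] t = t"
| "leaf_map (w # ws) t = (if t \<le> snd w then shifts ws (right_map w (to_rep w t)) else leaf_map ws t)"

lemma shifts_append: "shifts (ws @ ws') t = shifts ws' (shifts ws t)"
  by (induction ws arbitrary: t) simp_all

lemma leaf_map_append_left:
  "\<exists>w\<in>set ws. t \<le> snd w \<Longrightarrow> leaf_map (ws @ ws') t = shifts ws' (leaf_map ws t)"
  by (induction ws) (auto simp: shifts_append)

lemma leaf_map_append_right:
  "\<forall>w\<in>set ws. snd w < t \<Longrightarrow> leaf_map (ws @ ws') t = leaf_map ws' t"
  by (induction ws) auto

lemma split_map_K: "u \<in> std \<Longrightarrow> split_map u \<in> K"
  using splits_split_map by (simp add: splits_def)

lemma tree_map_K: "u \<in> std \<Longrightarrow> tree_map T u \<in> K"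
  by (induction T arbitrary: u) (simp_all add: maps_in_K m_closed std_lc std_rc split_map_K)

lemma tree_map_Fork:
  assumes "u \<in> std" "t \<in> {0..1}"
  shows "tree_map (Fork l r) u t = tree_map r (rc u) (tree_map l (lc u) (split_map u t))"
proof -
  have K: "tree_map r (rc u) \<in> K" "tree_map l (lc u) \<in> K" "split_map u \<in> K"
    using assms tree_map_K split_map_K std_lc std_rc by auto
  show ?thesis
    using F_mult[OF in_F[OF K(1)] in_F[OF m_closed[OF K(2,3)]] assms(2)] F_mult[OF in_F[OF K(2)] in_F[OF K(3)] assms(2)]
    by simp
qed

lemma left_map_mono:
  assumes "u \<in> std" "s \<in> {fst u..snd u}" "t \<in> {fst u..snd u}" "s \<le> t"
  shows "left_map u (to_rep u s) \<le> left_map u (to_rep u t)"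
proof -
  have "to_rep u s \<le> to_rep u t" unfolding to_rep_def
    using lin_mono_le std_bounds(5) rep_std assms by blast
  then show ?thesis using to_rep_range(2)[OF assms(1)] assms by (intro F_le[OF maps_in_F(1)]) auto
qed

lemma left_map_range: "u \<in> std \<Longrightarrow> t \<in> {fst u..snd u} \<Longrightarrow> left_map u (to_rep u t) \<in> {0..1}"
  using F_range[OF maps_in_F(1)] to_rep_range(2) by blast

lemma tree_map_right:
  assumes "u \<in> std" "t \<in> {left_map u (snd (rep u))..1}"
  shows "tree_map T u t = shift u t"
  using assms
proof (induction T arbitrary: u t)
  case (Fork l r)
  note u = Fork.prems(1)
  note b = std_bounds[OF u] and ul = std_lc[OF u] and ur = std_rc[OF u]
  let ?e = "split_map u"
  have e: "splits u ?e" using splits_split_map[OF u] .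
  have eK: "?e \<in> thompson_carrier" using split_map_K[OF u] in_F by blast
  have rs: "to_rep u (snd u) = snd (rep u)" "to_rep (lc u) (mid u) = snd (rep (lc u))"
    "to_rep (rc u) (snd u) = snd (rep (rc u))"
    using to_rep_ends(2)[OF u] to_rep_ends(2)[OF ul] to_rep_ends(2)[OF ur] by simp_all
  have pm: "left_map u (to_rep u (mid u)) \<in> {0..1}" "left_map u (to_rep u (snd u)) \<in> {0..1}"
    using left_map_range[OF u] b by auto
  have le: "left_map u (to_rep u (mid u)) \<le> left_map u (to_rep u (snd u))"
    using left_map_mono[OF u, of "mid u" "snd u"] b by auto
  have t: "left_map u (to_rep u (snd u)) \<le> t" "t \<in> {0..1}" "t \<le> 1"
    using Fork.prems(2) pm unfolding rs by auto
  have et: "?e t \<in> {0..1}" using F_range[OF eK t(2)] .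
  have m: "mid u \<in> {fst u..mid u}" "snd u \<in> {mid u..snd u}" using b by auto
  have "left_map (lc u) (snd (rep (lc u))) = ?e (left_map u (to_rep u (mid u)))"
    using e m(1) rs(2) unfolding splits_def by metis
  also have "\<dots> \<le> ?e t" using F_le[OF eK] pm le t by auto
  finally have 1: "tree_map l (lc u) (?e t) = shift (lc u) (?e t)"
    using et by (intro Fork.IH(1)[OF ul]) auto
  have "left_map (rc u) (snd (rep (rc u))) = shift (lc u) (?e (left_map u (to_rep u (snd u))))"
    using e m(2) rs(3) unfolding splits_def by metis
  also have "\<dots> \<le> shift (lc u) (?e t)"
    using F_le[OF eK, of "left_map u (to_rep u (snd u))" t] pm t F_range[OF eK pm(2)] et
    by (intro F_le[OF maps_in_F(3)]) auto
  finally have 2: "tree_map r (rc u) (shift (lc u) (?e t)) = shift (rc u) (shift (lc u) (?e t))"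
    using F_range[OF maps_in_F(3) et] by (intro Fork.IH(2)[OF ur]) auto
  have "shift (rc u) (shift (lc u) (?e t)) = shift u t"
    using e Fork.prems(2) unfolding splits_def by blast
  then show ?case using tree_map_Fork[OF u t(2)] 1 2 by simp
qed simp

lemma tree_map_le:
  assumes u: "u \<in> std" and t: "0 \<le> t" "t \<le> left_map u (snd (rep u))"
  shows "tree_map T u t \<in> {0..orbit_rep (snd u)}"
proof -
  have K: "tree_map T u \<in> thompson_carrier" using tree_map_K[OF u] in_F by blast
  have r: "snd (rep u) \<in> {0..1}" using std_bounds[OF rep_std[OF u]] by auto
  have m: "left_map u (snd (rep u)) \<in> {0..1}" using F_range[OF maps_in_F(1) r] .
  have "tree_map T u t \<le> tree_map T u (left_map u (snd (rep u)))"
    using t m by (intro F_le[OF K]) auto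
  also have "\<dots> = orbit_rep (snd u)" using tree_map_right[OF u] m shift_end[OF u] by auto
  finally show ?thesis using F_range[OF K, of t] t m by auto
qed

lemma orbit_rep_le_left_map:
  assumes u: "u \<in> std" shows "orbit_rep (fst u) \<le> left_map u (snd (rep u))"
  using left_map_mono[OF u, of "fst u" "snd u"] std_bounds[OF u] to_rep_ends[OF u] left_map_fst[OF u] by auto

lemma tree_map_left:
  assumes "u \<in> std" "t \<in> {0..orbit_rep (fst u)}"
  shows "tree_map T u t = shifts (leaves T u) t"
  using assms
proof (induction T arbitrary: u t)
  case (Fork l r)
  note u = Fork.prems(1)
  note b = std_bounds[OF u] and ul = std_lc[OF u] and ur = std_rc[OF u]
  have "orbit_rep (fst u) \<in> {0..1}" using b by (intro orbit_rep_range) auto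
  then have t: "t \<in> {0..1}" using Fork.prems(2) by auto
  have e: "split_map u t = t" using splits_split_map[OF u] Fork.prems(2) unfolding splits_def by blast
  have 1: "tree_map l (lc u) t = shifts (leaves l (lc u)) t"
    using Fork.prems(2) by (intro Fork.IH(1)[OF ul]) simp
  have "tree_map l (lc u) t \<in> {0..orbit_rep (snd (lc u))}"
    using Fork.prems(2) orbit_rep_le_left_map[OF ul] by (intro tree_map_le[OF ul]) auto
  then have "tree_map r (rc u) (tree_map l (lc u) t) = shifts (leaves r (rc u)) (tree_map l (lc u) t)"
    by (intro Fork.IH(2)[OF ur]) simp
  then show ?case using tree_map_Fork[OF u t] e 1 by (simp add: shifts_append)
qed simp

lemma tree_map_leaf_map:
  assumes "u \<in> std" "t \<in> {fst u..snd u}"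
  shows "tree_map T u (left_map u (to_rep u t)) = leaf_map (leaves T u) t"
  using assms
proof (induction T arbitrary: u)
  case Tip
  then show ?case using shift_left_map to_rep_range(2) by simp
next
  case (Fork l r)
  note u = Fork.prems(1)
  note b = std_bounds[OF u] and ul = std_lc[OF u] and ur = std_rc[OF u]
  let ?e = "split_map u" and ?p = "left_map u (to_rep u t)"
  have e: "splits u ?e" using splits_split_map[OF u] .
  have eK: "?e \<in> thompson_carrier" using split_map_K[OF u] in_F by blast
  have p: "?p \<in> {0..1}" using left_map_range[OF u Fork.prems(2)] .
  show ?case
  proof (cases "t \<le> mid u")
    case True
    then have t: "t \<in> {fst (lc u)..snd (lc u)}" using Fork.prems(2) by simp
    have ep: "?e ?p = left_map (lc u) (to_rep (lc u) t)" using e t unfolding splits_def by simp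
    have l: "tree_map l (lc u) (?e ?p) = leaf_map (leaves l (lc u)) t"
      unfolding ep using Fork.IH(1)[OF ul t] .
    have "tree_map l (lc u) (?e ?p) \<in> {0..orbit_rep (snd (lc u))}"
    proof (rule tree_map_le[OF ul])
      show "0 \<le> ?e ?p" using F_range[OF eK p] by simp
      show "?e ?p \<le> left_map (lc u) (snd (rep (lc u)))"
        using left_map_mono[OF ul t, of "snd (lc u)"] t to_rep_ends(2)[OF ul] ep by simp
    qed
    then have "tree_map r (rc u) (tree_map l (lc u) (?e ?p)) = shifts (leaves r (rc u)) (leaf_map (leaves l (lc u)) t)"
      unfolding l by (intro tree_map_left[OF ur]) simp
    moreover have "\<exists>w\<in>set (leaves l (lc u)). t \<le> snd w" using leaves_cover[OF ul] True by simp
    ultimately show ?thesis using tree_map_Fork[OF u p] leaf_map_append_left by simp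
  next
    case False
    then have t: "t \<in> {fst (rc u)..snd (rc u)}" using Fork.prems(2) by simp
    have m: "mid u \<in> {fst u..snd u}" "mid u \<in> {fst u..mid u}" using b by auto
    have "left_map (lc u) (snd (rep (lc u))) = ?e (left_map u (to_rep u (mid u)))"
      using e m(2) to_rep_ends(2)[OF ul] unfolding splits_def by simp
    also have "\<dots> \<le> ?e ?p"
      using left_map_mono[OF u m(1) Fork.prems(2)] False left_map_range[OF u m(1)] p
      by (intro F_le[OF eK]) auto
    finally have l: "tree_map l (lc u) (?e ?p) = shift (lc u) (?e ?p)"
      using F_range[OF eK p] by (intro tree_map_right[OF ul]) simp
    also have "\<dots> = left_map (rc u) (to_rep (rc u) t)" using e t unfolding splits_def by simp
    finally have "tree_map r (rc u) (tree_map l (lc u) (?e ?p)) = leaf_map (leaves r (rc u)) t"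
      using Fork.IH(2)[OF ur t] by simp
    moreover have "\<forall>w\<in>set (leaves l (lc u)). snd w < t" using leaves_sub[OF ul] False by force
    ultimately show ?thesis using tree_map_Fork[OF u p] leaf_map_append_right by simp
  qed
qed

lemma shifts_img:
  assumes "\<forall>w\<in>set ws. eqv K w (img f w)"
  shows "shifts (map (img f) ws) t = shifts ws t"
  using assms
proof (induction ws arbitrary: t)
  case (Cons w ws)
  then have "eqv K w (img f w)" by simp
  then have "rep (img f w) = rep w" by (rule rep_eq[symmetric])
  then show ?case using Cons by (simp add: shift_def left_map_def right_map_def)
qed simp

lemma leaf_map_img:
  assumes "f \<in> K" "\<forall>w\<in>set ws. w \<in> std \<and> good f w" "chain p ws q" "p \<le> t" "t \<le> q" "0 \<le> p" "q \<le> 1" "ws \<noteq> []"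
  shows "leaf_map (map (img f) ws) (f t) = leaf_map ws t"
  using assms
proof (induction ws arbitrary: p)
  case (Cons w ws)
  note fF = in_F[OF Cons.prems(1)]
  have w: "w \<in> std" "good f w" "fst w = p" using Cons.prems by auto
  have ev: "\<forall>v\<in>set (w # ws). eqv K v (img f v)" using Cons.prems(1,2) by (auto simp: eqv_def)
  have ew: "eqv K w (img f w)" using ev by simp
  have req: "rep (img f w) = rep w" using rep_eq[OF ew] by simp
  note b = std_bounds[OF w(1)]
  show ?case
  proof (cases "t \<le> snd w")
    case True
    then have t: "t \<in> {fst w..snd w}" using Cons.prems w by simp
    then have "f t \<le> f (snd w)" using b True Cons.prems by (intro F_le[OF fF]) auto
    moreover have "to_rep (img f w) (f t) = to_rep w t"
      using to_rep_lin[of w "img f w"] ev goodD[OF w(2) t] by simp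
    ultimately show ?thesis using True shifts_img[of ws f] ev req by (simp add: right_map_def)
  next
    case False
    then have "f (snd w) < f t" using b Cons.prems by (intro F_less[OF fF]) auto
    moreover have "ws \<noteq> []" using False Cons.prems by auto
    then have "leaf_map (map (img f) ws) (f t) = leaf_map ws t"
      using Cons.prems False b by (intro Cons.IH[of "snd w"]) auto
    ultimately show ?thesis using False by simp
  qed
qed simp

definition nonfree :: "ivl set" where
  "nonfree = {u \<in> std. \<exists>k\<in>K. \<not> good k u}"

definition core :: "ivl set" where
  "core = {(0, 1)} \<union> nonfree \<union> lc ` nonfree \<union> rc ` nonfree"

definition core_gens :: "(real \<Rightarrow> real) set" where
  "core_gens = {left_map (0, 1)} \<union> shift ` core \<union> split_map ` nonfree"

lemma core_std: "core \<subseteq> std" "nonfree \<subseteq> std"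
  by (auto simp: core_def nonfree_def std_lc std_rc)

lemma core_gens_K: "core_gens \<subseteq> K"
  using core_std split_map_K by (auto simp: core_gens_def maps_in_K)

lemma tree_map_word:
  assumes "u \<in> core" "set (nodes T u) \<subseteq> nonfree"
  shows "tree_map T u \<in> word_products F core_gens (2 * length (nodes T u) + 1)"
  using assms
proof (induction T arbitrary: u)
  case Tip
  have "shift u \<in> core_gens" using Tip by (auto simp: core_gens_def)
  then show ?case using F_word_products_single[of core_gens] core_gens_K in_F by auto
next
  case (Fork l r)
  have S: "core_gens \<subseteq> thompson_carrier" using core_gens_K in_F by auto
  have u: "u \<in> nonfree" using Fork.prems by simp
  have "split_map u \<in> core_gens" using u by (auto simp: core_gens_def)
  then have e: "split_map u \<in> word_products F core_gens 1" using F_word_products_single[OF S] by auto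
  have "lc u \<in> core" "rc u \<in> core" using u by (auto simp: core_def)
  then have "tree_map l (lc u) \<in> word_products F core_gens (2 * length (nodes l (lc u)) + 1)"
    "tree_map r (rc u) \<in> word_products F core_gens (2 * length (nodes r (rc u)) + 1)"
    using Fork by auto
  from F_word_products_mult[OF S this(2) F_word_products_mult[OF S this(1) e]]
  show ?case by (simp add: algebra_simps)
qed

lemma core_words:
  assumes f: "f \<in> K"
  shows "\<exists>j\<le>4 * (card (bad f) + 1). f \<in> word_products F core_gens j"
proof -
  note fF = in_F[OF f]
  let ?I = "(0, 1) :: ivl" and ?g = "inv\<^bsub>F\<^esub> f"
  have gF: "?g \<in> thompson_carrier" using F.inv_closed fF by simp
  have S: "core_gens \<subseteq> thompson_carrier" using core_gens_K in_F by auto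
  obtain T where good: "\<forall>w\<in>set (leaves T ?I). good f w" and inn: "\<forall>v\<in>set (nodes T ?I). \<not> good f v"
    using minimal_tree[OF F_deep[OF fF]] by blast
  let ?ws = "leaves T ?I"
  have wstd: "\<forall>w\<in>set ?ws. w \<in> std" using leaves_std[OF unit_std] by blast
  have ch: "chain 0 ?ws 1" using chain_leaves[of ?I T] by simp
  have "chain (f p) (map (img f) ws) (f q)" if "chain p ws q" for p ws q
    using that by (induction ws arbitrary: p) auto
  from this[OF ch] have "chain (fst ?I) (map (img f) ?ws) (snd ?I)" using F_ends[OF fF] by simp
  moreover have "set (map (img f) ?ws) \<subseteq> std" using good img_std by auto
  ultimately obtain T' where T': "leaves T' ?I = map (img f) ?ws"
    using tree_of_chain[OF unit_std] by blast
  have len: "length (nodes T' ?I) = length (nodes T ?I)"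
    using length_leaves[of T' ?I] length_leaves[of T ?I] T' by simp
  have "set (nodes T ?I) \<subseteq> bad f" using inn node_std[OF unit_std] by (auto simp: bad_def)
  then have "length (nodes T ?I) \<le> card (bad f)"
    using card_mono[OF finite_bad[OF fF]] distinct_card[OF distinct_nodes[OF unit_std]] by metis
  have nf: "set (nodes T ?I) \<subseteq> nonfree"
    using inn node_std[OF unit_std] f by (auto simp: nonfree_def)
  have nf': "set (nodes T' ?I) \<subseteq> nonfree"
  proof
    fix v assume v: "v \<in> set (nodes T' ?I)"
    have vs: "v \<in> std" using node_std[OF unit_std] v by blast
    have "\<not> good ?g v"
    proof
      assume gv: "good ?g v"
      let ?u = "img ?g v"
      have us: "?u \<in> std" using img_std[OF gv] .
      have fu: "good f ?u" "img f ?u = v"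
        using good_inv_F[OF gF vs gv] F.inv_inv[of f] fF by auto
      obtain w' where w': "w' \<in> set (leaves T' ?I)" "fst w' = fst v" "snd w' < snd v"
        using node_above_leaf[OF unit_std v] by blast
      then obtain w where w: "w \<in> set ?ws" "w' = img f w" unfolding T' by auto
      have ws: "w \<in> std" using wstd w by blast
      note bw = std_bounds[OF ws] and bu = std_bounds[OF us]
      have "f (fst w) = f (fst ?u)" "f (snd w) < f (snd ?u)"
        using w' w(2) fu(2) by (metis fst_img) (metis snd_img w'(3) w(2) fu(2))
      then have "fst w = fst ?u" "snd w < snd ?u"
        using F_inj[OF fF, of "fst w" "fst ?u"] F_le[OF fF, of "snd ?u" "snd w"] bw bu by force+
      then have "?u \<in> set (nodes T ?I)"
        using bu by (intro above_leaf_nodes[OF unit_std w(1) us]) auto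
      then show False using inn fu by blast
    qed
    then show "v \<in> nonfree" using vs m_inv_closed[OF f] by (auto simp: nonfree_def)
  qed
  have I: "?I \<in> core" by (simp add: core_def)
  note W = tree_map_word[OF I nf] and W' = tree_map_word[OF I nf']
  let ?M = "tree_map T ?I" and ?M' = "tree_map T' ?I" and ?A = "left_map ?I"
  have MF: "?M \<in> thompson_carrier" "?M' \<in> thompson_carrier" "?A \<in> thompson_carrier"
    using tree_map_K[OF unit_std] maps_in_F(1) in_F by auto
  have repI: "rep ?I = ?I"
  proof -
    obtain k where k: "k \<in> K" "img k ?I = rep ?I" using eqv_rep[OF unit_std] by (auto simp: eqv_def)
    then show ?thesis using F_ends[OF in_F[OF k(1)]] by (simp add: img_def)
  qed
  have toI: "to_rep ?I t = t" for t using lin_self[of ?I t] by (simp add: to_rep_def repI)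
  have key: "?M' (?A (f t)) = ?M (?A t)" if t: "t \<in> {0..1}" for t
  proof -
    have ft: "f t \<in> {0..1}" using F_range[OF fF t] .
    have "?M' (?A (f t)) = leaf_map (map (img f) ?ws) (f t)"
      using tree_map_leaf_map[OF unit_std, of "f t" T'] ft T' toI by simp
    also have "\<dots> = leaf_map ?ws t"
      using good wstd ch t by (intro leaf_map_img[OF f]) auto
    also have "\<dots> = ?M (?A t)" using tree_map_leaf_map[OF unit_std, of t T] t toI by simp
    finally show ?thesis .
  qed
  let ?h = "inv\<^bsub>F\<^esub> ?A \<otimes>\<^bsub>F\<^esub> (inv\<^bsub>F\<^esub> ?M' \<otimes>\<^bsub>F\<^esub> (?M \<otimes>\<^bsub>F\<^esub> ?A))"
  have A: "?A \<in> word_products F core_gens 1"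
    by (rule F_word_products_single[OF S]) (simp add: core_gens_def)
  note wp = F_word_products_mult[OF S F_word_products_inv[OF S A]
      F_word_products_mult[OF S F_word_products_inv[OF S W'] F_word_products_mult[OF S W A]]]
  have "f = ?h"
  proof -
    have c: "?A \<in> carrier F" "?M \<in> carrier F" "?M' \<in> carrier F" "f \<in> carrier F" using MF fF by simp_all
    have "?M' \<otimes>\<^bsub>F\<^esub> (?A \<otimes>\<^bsub>F\<^esub> f) = ?M \<otimes>\<^bsub>F\<^esub> ?A"
    proof (rule F_eqI)
      fix t :: real assume t: "t \<in> {0..1}"
      have "(?M' \<otimes>\<^bsub>F\<^esub> (?A \<otimes>\<^bsub>F\<^esub> f)) t = ?M' ((?A \<otimes>\<^bsub>F\<^esub> f) t)"
        by (rule F_mult) (use MF fF t F.m_closed[of ?A f] in auto)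
      also have "(?A \<otimes>\<^bsub>F\<^esub> f) t = ?A (f t)" by (rule F_mult[OF MF(3) fF t])
      also have "?M' (?A (f t)) = ?M (?A t)" by (rule key[OF t])
      also have "\<dots> = (?M \<otimes>\<^bsub>F\<^esub> ?A) t" by (rule F_mult[OF MF(1,3) t, symmetric])
      finally show "(?M' \<otimes>\<^bsub>F\<^esub> (?A \<otimes>\<^bsub>F\<^esub> f)) t = (?M \<otimes>\<^bsub>F\<^esub> ?A) t" .
    qed (use c F.m_closed in \<open>simp_all flip: carrier_F\<close>)
    then show ?thesis using c F.inv_solve_left F.inv_closed F.m_closed by (metis (no_types, lifting))
  qed
  with wp have "f \<in> word_products F core_gens
      (1 + (2 * length (nodes T' ?I) + 1 + (2 * length (nodes T ?I) + 1 + 1)))"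
    by (rule ssubst[rotated])
  moreover have "1 + (2 * length (nodes T' ?I) + 1 + (2 * length (nodes T ?I) + 1 + 1)) \<le> 4 * (card (bad f) + 1)"
    unfolding len using \<open>length (nodes T ?I) \<le> card (bad f)\<close> by simp
  ultimately show ?thesis by blast
qed

end

locale finite_core = glue_closed +
  assumes finite_classes: "\<exists>Z. finite Z \<and> Z \<subseteq> std \<and> (\<forall>u\<in>std. (\<exists>k\<in>K. \<not> good k u) \<longrightarrow> (\<exists>z\<in>Z. eqv K u z))"
begin

lemma finite_core_gens: "finite core_gens"
proof -
  obtain Z where Z: "finite Z" "\<And>u. u \<in> nonfree \<Longrightarrow> \<exists>z\<in>Z. eqv K u z"
    using finite_classes unfolding nonfree_def by blast
  have "rep ` nonfree \<subseteq> rep ` Z" using Z(2) rep_eq by blast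
  then have n: "finite (rep ` nonfree)" by (rule finite_subset) (simp add: Z(1))
  have "rep ` lc ` nonfree \<subseteq> rep ` lc ` Z" using Z(2) rep_eq[OF eqv_lc] by blast
  then have l: "finite (rep ` lc ` nonfree)" by (rule finite_subset) (simp add: Z(1))
  have "rep ` rc ` nonfree \<subseteq> rep ` rc ` Z" using Z(2) rep_eq[OF eqv_rc] by blast
  then have r: "finite (rep ` rc ` nonfree)" by (rule finite_subset) (simp add: Z(1))
  from l r have c: "finite (rep ` core)" using n by (simp add: core_def image_Un)
  have "shift ` core \<subseteq> (\<lambda>v. orbit_map (snd v) \<otimes>\<^bsub>F\<^esub> inv\<^bsub>F\<^esub> (orbit_map (fst v))) ` rep ` core"
    by (auto simp: shift_def left_map_def right_map_def)
  then have "finite (shift ` core)" by (rule finite_subset) (simp add: c)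
  moreover have "split_map ` nonfree \<subseteq> (\<lambda>v. SOME e. splits v e) ` rep ` nonfree"
    by (auto simp: split_map_def)
  then have "finite (split_map ` nonfree)" by (rule finite_subset) (simp add: n)
  ultimately show ?thesis by (simp add: core_gens_def)
qed

end

lemma F_generate_iff:
  assumes S: "S \<subseteq> thompson_carrier"
  shows "f \<in> generate F S \<longleftrightarrow> (\<exists>n. f \<in> word_products F S n)"
proof
  assume "f \<in> generate F S"
  then show "\<exists>n. f \<in> word_products F S n"
  proof induction
    case one
    show ?case using F_word_products_one by blast
  next
    case (incl s)
    then show ?case using F_word_products_single[OF S] by blast
  next
    case (inv s)
    then show ?case using F_word_products_single[OF S] by blast
  next
    case (eng f g)
    then show ?case using F_word_products_mult[OF S] by blast
  qed
next
  assume "\<exists>n. f \<in> word_products F S n"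
  then obtain w where "f = foldr (\<otimes>\<^bsub>F\<^esub>) w \<one>\<^bsub>F\<^esub>" "set w \<subseteq> S \<union> m_inv F ` S" by (auto simp: word_products_def)
  then show "f \<in> generate F S"
  proof (induction w arbitrary: f)
    case Nil
    then show ?case by (simp add: generate.one)
  next
    case (Cons s w)
    then have "s \<in> generate F S" by (auto intro: generate.incl generate.inv)
    then show ?case using Cons by (auto intro: generate.eng)
  qed
qed

lemma F_word_products_subst:
  assumes S: "S \<subseteq> thompson_carrier"
    and T: "\<And>t. t \<in> T \<Longrightarrow> \<exists>j\<le>J. t \<in> word_products F S j"
    and f: "f \<in> word_products F T n"
  shows "\<exists>j\<le>J * n. f \<in> word_products F S j"
proof -
  have L: "\<exists>j\<le>J. t \<in> word_products F S j" if "t \<in> T \<union> m_inv F ` T" for t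
    using that T F_word_products_inv[OF S] by blast
  obtain w where "f = foldr (\<otimes>\<^bsub>F\<^esub>) w \<one>\<^bsub>F\<^esub>" "length w = n" "set w \<subseteq> T \<union> m_inv F ` T"
    using f by (auto simp: word_products_def)
  then show ?thesis
  proof (induction w arbitrary: f n)
    case Nil
    then show ?case using F_word_products_one by auto
  next
    case (Cons s w)
    obtain i where i: "i \<le> J" "s \<in> word_products F S i" using L[of s] Cons.prems by auto
    obtain j where j: "j \<le> J * length w" "foldr (\<otimes>\<^bsub>F\<^esub>) w \<one>\<^bsub>F\<^esub> \<in> word_products F S j"
      using Cons.IH[of "foldr (\<otimes>\<^bsub>F\<^esub>) w \<one>\<^bsub>F\<^esub>" "length w"] Cons.prems by auto
    have "f \<in> word_products F S (i + j)"
      using F_word_products_mult[OF S i(2) j(2)] Cons.prems by simp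
    moreover have "i + j \<le> J * n" using i(1) j(1) Cons.prems(2) by auto
    ultimately show ?case by blast
  qed
qed

context finite_core
begin

lemma core_gens_generate: "finite_generating_set F K core_gens"
proof -
  have S: "core_gens \<subseteq> thompson_carrier" using core_gens_K in_F by auto
  have "generate F core_gens \<subseteq> K"
    by (rule F.generate_subgroup_incl[OF core_gens_K]) unfold_locales
  moreover have "K \<subseteq> generate F core_gens"
    using core_words F_generate_iff[OF S] by blast
  ultimately show ?thesis using S finite_core_gens by (simp add: finite_generating_set_def)
qed

lemma distortion_bound:
  assumes S: "finite_generating_set F (carrier F) S" and T: "finite_generating_set F K T"
  shows "\<exists>C. \<forall>n. distortion F K S T n \<le> C * n"
proof -
  have SF: "S \<subseteq> thompson_carrier" "finite S" using S by (auto simp: finite_generating_set_def)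
  have TF: "T \<subseteq> thompson_carrier" and gT: "generate F T = K" using T by (auto simp: finite_generating_set_def)
  let ?L = "S \<union> m_inv F ` S"
  have L: "?L \<subseteq> thompson_carrier" using SF F.inv_closed by auto
  obtain M where M: "\<And>s. s \<in> ?L \<Longrightarrow> card (bad s) \<le> M"
  proof
    fix s assume "s \<in> ?L"
    then show "card (bad s) \<le> Max ((\<lambda>s. card (bad s)) ` ?L)" using SF by (intro Max_ge) auto
  qed
  have "\<exists>j. t \<in> word_products F T j" if "t \<in> core_gens" for t
    using that core_gens_K gT F_generate_iff[OF TF] by blast
  then obtain j where j: "\<And>t. t \<in> core_gens \<Longrightarrow> t \<in> word_products F T (j t)" by metis
  let ?J = "Max (j ` core_gens)"
  have J: "\<exists>i\<le>?J. t \<in> word_products F T i" if "t \<in> core_gens" for t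
    using that j finite_core_gens by (intro exI[of _ "j t"]) auto
  have "distortion F K S T n \<le> 4 * ?J * (M + 1) * n" for n
    unfolding distortion_def
  proof (rule Least_le, rule subsetI)
    fix f assume f: "f \<in> K \<inter> word_products F S n"
    show "f \<in> (\<Union>i\<le>4 * ?J * (M + 1) * n. word_products F T i)"
    proof (cases "n = 0")
      case True
      then show ?thesis using f F_word_products_one[of T] by (auto simp: word_products_def)
    next
      case False
      obtain w where w: "f = foldr (\<otimes>\<^bsub>F\<^esub>) w \<one>\<^bsub>F\<^esub>" "length w = n" "set w \<subseteq> ?L"
        using f by (auto simp: word_products_def)
      have "card (bad f) \<le> M * n"
        using card_bad_foldr[of w M] w L M by blast
      then have "4 * (card (bad f) + 1) \<le> 4 * (M * n + 1)" by simp
      moreover obtain i where i: "i \<le> 4 * (card (bad f) + 1)" "f \<in> word_products F core_gens i"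
        using core_words f by blast
      ultimately have "i \<le> 4 * (M * n + 1)" using order_trans by blast
      also have "\<dots> \<le> 4 * (M + 1) * n" using False by (simp add: algebra_simps)
      finally have "?J * i \<le> ?J * (4 * (M + 1) * n)" by (rule mult_le_mono2)
      moreover obtain i' where "i' \<le> ?J * i" "f \<in> word_products F T i'"
        using F_word_products_subst[OF TF J i(2)] by blast
      ultimately have "i' \<le> ?J * (4 * (M + 1) * n)" by linarith
      then have "i' \<le> 4 * ?J * (M + 1) * n" by (simp only: mult_ac)
      then show ?thesis using \<open>f \<in> word_products F T i'\<close> by blast
    qed
  qed
  then show ?thesis by blast
qed

end

lemma dint_of_numerals: "(0, 1/2) \<in> dint 1" "(1/2, 1) \<in> dint 1"
  "(0, 1/4) \<in> dint 2" "(1/4, 1/2) \<in> dint 2" "(1/2, 3/4) \<in> dint 2" "(3/4, 1) \<in> dint 2"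
  "(1/2, 5/8) \<in> dint 3" "(5/8, 3/4) \<in> dint 3" "(3/4, 7/8) \<in> dint 3" "(7/8, 1) \<in> dint 3"
  by (simp_all add: dint_def)

lemmas std_of_numerals = dint_of_numerals[THEN dint_std]

lemma goodI:
  assumes "u \<in> std" "v \<in> std" "\<And>t. t \<in> {fst u..snd u} \<Longrightarrow> f t = lin u v t"
  shows "good f u" "img f u = v"
proof -
  show "img f u = v" using assms(3)[of "fst u"] assms(3)[of "snd u"] std_bounds[OF assms(1)]
    by (simp add: img_def prod_eq_iff)
  then show "good f u" using assms by (simp add: good_def)
qed

subsection \<open>Finite generation of Thompson's group\<close>

definition gen_a :: "real \<Rightarrow> real" where
  "gen_a = (\<lambda>t\<in>{0..1}. if t \<le> 1/4 then 2 * t else if t \<le> 1/2 then t + 1/4 else t / 2 + 1/2)"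

definition gen_b :: "real \<Rightarrow> real" where
  "gen_b = (\<lambda>t\<in>{0..1}. if t \<le> 1/2 then t else if t \<le> 5/8 then 2 * t - 1/2
     else if t \<le> 3/4 then t + 1/8 else t / 2 + 1/2)"

lemma gen_a_good:
  "good gen_a (0, 1/4)" "img gen_a (0, 1/4) = (0, 1/2)"
  "good gen_a (1/4, 1/2)" "img gen_a (1/4, 1/2) = (1/2, 3/4)"
  "good gen_a (1/2, 1)" "img gen_a (1/2, 1) = (3/4, 1)"
  by (rule goodI[OF std_of_numerals(3) std_of_numerals(1)] goodI[OF std_of_numerals(4) std_of_numerals(5)]
      goodI[OF std_of_numerals(2) std_of_numerals(6)], force simp: gen_a_def lin_def field_simps)+

lemma gen_b_good:
  "good gen_b (0, 1/2)"
  "good gen_b (1/2, 5/8)" "img gen_b (1/2, 5/8) = (1/2, 3/4)"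
  "good gen_b (5/8, 3/4)" "img gen_b (5/8, 3/4) = (3/4, 7/8)"
  "good gen_b (3/4, 1)"
  by (rule goodI[OF std_of_numerals(1) std_of_numerals(1)] goodI[OF std_of_numerals(7) std_of_numerals(5)]
      goodI[OF std_of_numerals(8) std_of_numerals(9)] goodI[OF std_of_numerals(6) std_of_numerals(10)],
      force simp: gen_b_def lin_def field_simps)+

lemma dint_1: "dint 1 = {(0, 1/2), (1/2, 1)}"
  using dint_Suc[of 0] by (simp add: lc_def rc_def mid_def insert_commute)

lemma dint_2: "dint 2 = {lc (0, 1/2), rc (0, 1/2), lc (1/2, 1), rc (1/2, 1)}"
  using dint_Suc[of 1] unfolding dint_1 numeral_2_eq_2[symmetric] Suc_1 by auto

lemma halves: "lc (0, 1/2) = (0, 1/4)" "rc (0, 1/2) = (1/4, 1/2)"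
  "lc (1/2, 1) = (1/2, 3/4)" "rc (1/2, 1) = (3/4, 1)"
  "lc (1/2, 3/4) = (1/2, 5/8)" "rc (1/2, 3/4) = (5/8, 3/4)"
  "lc (3/4, 1) = (3/4, 7/8)" "rc (3/4, 1) = (7/8, 1)"
  by (simp_all add: lc_def rc_def mid_def)

lemma dint_3: "dint 3 = {lc (0, 1/4), rc (0, 1/4), lc (1/4, 1/2), rc (1/4, 1/2),
    (1/2, 5/8), (5/8, 3/4), (3/4, 7/8), (7/8, 1)}"
  using dint_Suc[of 2] unfolding dint_2 halves by (auto simp: halves)

lemma gen_a_F: "gen_a \<in> thompson_carrier"
proof (rule thompson_carrierI[where n=2])
  have "good gen_a (lc (1/2, 1))" "good gen_a (rc (1/2, 1))"
    using good_lc[OF std_of_numerals(2)] good_rc[OF std_of_numerals(2)] gen_a_good(5) by blast+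
  then show "\<forall>u\<in>dint 2. good gen_a u"
    unfolding dint_2 using gen_a_good(1,3) by (simp add: halves)
qed (simp_all add: gen_a_def)

lemma gen_b_F: "gen_b \<in> thompson_carrier"
proof (rule thompson_carrierI[where n=3])
  have l: "good gen_b (lc (0, 1/2))" "good gen_b (rc (0, 1/2))"
    using good_lc[OF std_of_numerals(1)] good_rc[OF std_of_numerals(1)] gen_b_good(1) by blast+
  have r: "good gen_b (lc (3/4, 1))" "good gen_b (rc (3/4, 1))"
    using good_lc[OF std_of_numerals(6)] good_rc[OF std_of_numerals(6)] gen_b_good(6) by blast+
  have "good gen_b (lc (0, 1/4))" "good gen_b (rc (0, 1/4))" "good gen_b (lc (1/4, 1/2))" "good gen_b (rc (1/4, 1/2))"
    using l good_lc[OF std_of_numerals(3)] good_rc[OF std_of_numerals(3)]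
      good_lc[OF std_of_numerals(4)] good_rc[OF std_of_numerals(4)] unfolding halves by blast+
  then show "\<forall>u\<in>dint 3. good gen_b u"
    unfolding dint_3 using r gen_b_good by (simp add: halves)
qed (simp_all add: gen_b_def)

interpretation F_glue: glue_closed thompson_carrier
proof (rule glue_closed.intro)
  show "subgroup thompson_carrier F" using F.subgroup_self by simp
qed (unfold_locales, rule glue_F)

lemma F_eqv_coarser:
  assumes "u \<in> dint (k + 3)" shows "\<exists>v\<in>dint (k + 2). eqv thompson_carrier u v"
  using assms
proof (induction k arbitrary: u)
  case 0
  let ?e = "eqv thompson_carrier"
  have e1: "?e (0, 1/4) (0, 1/2)" and e2: "?e (1/4, 1/2) (1/2, 3/4)" and e3: "?e (1/2, 1) (3/4, 1)"
    unfolding eqv_def using gen_a_F gen_a_good std_of_numerals by blast+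
  have e4: "?e (1/2, 5/8) (1/2, 3/4)" and e5: "?e (5/8, 3/4) (3/4, 7/8)"
    unfolding eqv_def using gen_b_F gen_b_good std_of_numerals by blast+
  note lc = F_glue.eqv_lc and rc = F_glue.eqv_rc and tr = F_glue.eqv_trans and sy = F_glue.eqv_sym
  have e6: "?e (3/4, 7/8) (1/2, 3/4)" "?e (7/8, 1) (3/4, 1)"
    using sy[OF lc[OF e3]] sy[OF rc[OF e3]] by (simp_all add: halves)
  have e7: "?e (5/8, 3/4) (1/2, 3/4)" using tr[OF e5 e6(1)] .
  have e8: "?e (lc (1/4, 1/2)) (1/2, 3/4)" "?e (rc (1/4, 1/2)) (1/2, 3/4)"
    using tr[OF lc[OF e2]] tr[OF rc[OF e2]] e4 e7 by (simp_all add: halves)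
  have e9: "?e (lc (0, 1/4)) (0, 1/4)" "?e (rc (0, 1/4)) (1/4, 1/2)"
    using lc[OF e1] rc[OF e1] by (simp_all add: halves)
  have "u \<in> dint 3" using 0 by simp
  then have "\<exists>v\<in>{(0, 1/4), (1/4, 1/2), (1/2, 3/4), (3/4, 1)}. ?e u v"
    unfolding dint_3 using e4 e6 e7 e8 e9 by blast
  moreover have "{(0, 1/4), (1/4, 1/2), (1/2, 3/4), (3/4, 1)} \<subseteq> dint (0 + 2)"
    unfolding add_0 using dint_of_numerals(3-6) by blast
  ultimately show ?case by blast
next
  case (Suc k)
  then obtain p where p: "p \<in> dint (k + 3)" "u = lc p \<or> u = rc p"
    using dint_parent[of u "k + 3"] unfolding add_Suc by blast
  then obtain v where v: "v \<in> dint (k + 2)" "eqv thompson_carrier p v" using Suc.IH by blast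
  then have "lc v \<in> dint (Suc k + 2)" "rc v \<in> dint (Suc k + 2)" using lc_dint[OF v(1)] rc_dint[OF v(1)] by simp_all
  then show ?case using p(2) F_glue.eqv_lc[OF v(2)] F_glue.eqv_rc[OF v(2)] by blast
qed

interpretation F_core: finite_core thompson_carrier
proof unfold_locales
  let ?Z = "dint 0 \<union> dint 1 \<union> dint 2"
  have "\<exists>z\<in>?Z. eqv thompson_carrier u z" if "u \<in> dint n" for u n
    using that
  proof (induction n arbitrary: u)
    case 0
    then show ?case using F_glue.eqv_refl dint_std by blast
  next
    case (Suc n)
    show ?case
    proof (cases "n < 2")
      case True
      then have "Suc n = 1 \<or> Suc n = 2" by linarith
      then have "u \<in> ?Z" using Suc.prems by (metis UnI1 UnI2)
      then show ?thesis using F_glue.eqv_refl[OF dint_std[OF Suc.prems]] by blast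
    next
      case False
      then have n: "Suc n = (n - 2) + 3" "n = (n - 2) + 2" by linarith+
      have "\<exists>v\<in>dint (n - 2 + 2). eqv thompson_carrier u v"
        using F_eqv_coarser[of u "n - 2"] Suc.prems unfolding n(1)[symmetric] .
      then obtain v where v: "v \<in> dint n" "eqv thompson_carrier u v"
        unfolding n(2)[symmetric] by blast
      then show ?thesis using Suc.IH[OF v(1)] F_glue.eqv_trans[OF v(2)] by blast
    qed
  qed
  then have "\<forall>u\<in>std. \<exists>z\<in>?Z. eqv thompson_carrier u z" unfolding std_def by blast
  moreover have "?Z \<subseteq> std" using dint_std by blast
  moreover have "finite ?Z" by simp
  ultimately show "\<exists>Z. finite Z \<and> Z \<subseteq> std \<and>
    (\<forall>u\<in>std. (\<exists>k\<in>thompson_carrier. \<not> good k u) \<longrightarrow> (\<exists>z\<in>Z. eqv thompson_carrier u z))"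
    by (intro exI[of _ ?Z]) simp
qed

lemma F_finitely_generated: "finitely_generated F (carrier F)"
  using F_core.core_gens_generate unfolding finitely_generated_def by auto

subsection \<open>Closures of finitely generated subgroups\<close>

lemma std_eq_mid:
  assumes v: "v \<in> std" and w: "w \<in> std" and eq: "mid v = mid w"
  shows "v = w"
proof -
  have no: "\<not> m < n" if m: "v \<in> dint m" and n: "w \<in> dint n" and eq: "mid v = mid w" for m n v w
  proof
    assume "m < n"
    have "mid v * 2 ^ Suc m \<in> \<int>" using rc_dint[OF m] unfolding dint_def by (simp del: power_Suc)
    then have "mid w * 2 ^ n \<in> \<int>" using lower_level_int[of "mid v" "Suc m" n] \<open>m < n\<close> eq by simp
    then consider "snd w \<le> mid w" | "mid w \<le> fst w" using dint_side[OF n] by blast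
    then show False using dint_bounds[OF n] by cases simp_all
  qed
  obtain m n where m: "v \<in> dint m" and n: "w \<in> dint n" using v w by (auto simp: std_def)
  have "m = n" using no[OF m n eq] no[OF n m eq[symmetric]] by linarith
  then show ?thesis using dint_mid[OF m] dint_mid[OF n] eq by (simp add: prod_eq_iff)
qed

lemma deep_induct:
  assumes "deep P" and step: "\<And>u. u \<in> std \<Longrightarrow> P (lc u) \<Longrightarrow> P (rc u) \<Longrightarrow> P u" and u: "u \<in> std"
  shows "P u"
proof -
  obtain n where n: "\<And>m u. m \<ge> n \<Longrightarrow> u \<in> dint m \<Longrightarrow> P u"
    using assms(1) unfolding deep_def eventually_sequentially by blast
  have "P u" if "u \<in> dint m" for u m
    using that
  proof (induction "n - m" arbitrary: m u)
    case 0
    then show ?case using n by simp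
  next
    case (Suc d)
    then have "d = n - Suc m" by simp
    then show ?case using Suc.hyps(1)[of "Suc m"] lc_dint[OF Suc.prems] rc_dint[OF Suc.prems]
        step[OF dint_std[OF Suc.prems]] by blast
  qed
  then show ?thesis using u unfolding std_def by blast
qed

lemma Cl_free:
  assumes f: "f \<in> Cl H" and u: "u \<in> std" and free: "\<forall>h\<in>H. good h u"
  shows "agree H f u"
proof -
  have "(\<forall>h\<in>H. good h u) \<longrightarrow> agree H f u"
  proof (rule deep_induct[OF _ _ u])
    show "deep (\<lambda>u. (\<forall>h\<in>H. good h u) \<longrightarrow> agree H f u)"
      using f unfolding Cl_iff by (auto elim: deep_mono)
  next
    fix u assume u: "u \<in> std" and l: "(\<forall>h\<in>H. good h (lc u)) \<longrightarrow> agree H f (lc u)"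
      and r: "(\<forall>h\<in>H. good h (rc u)) \<longrightarrow> agree H f (rc u)"
    note b = std_bounds[OF u]
    show "(\<forall>h\<in>H. good h u) \<longrightarrow> agree H f u"
    proof
      assume g: "\<forall>h\<in>H. good h u"
      then have "agree H f (lc u)" "agree H f (rc u)" using l r good_lc[OF u] good_rc[OF u] by blast+
      then obtain h k where h: "h \<in> H" "\<And>t. t \<in> {fst u..mid u} \<Longrightarrow> f t = h t"
        and k: "k \<in> H" "\<And>t. t \<in> {mid u..snd u} \<Longrightarrow> f t = k t" unfolding agree_def by auto
      have gh: "good h u" "good k u" using g h(1) k(1) by auto
      have "h (mid u) = k (mid u)" using h(2)[of "mid u"] k(2)[of "mid u"] b by simp
      then have "mid (img h u) = mid (img k u)" using good_mid[OF u gh(1)] good_mid[OF u gh(2)] by simp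
      then have i: "img h u = img k u" using std_eq_mid img_std gh by blast
      have "f t = h t" if t: "t \<in> {fst u..snd u}" for t
      proof (cases "t \<le> mid u")
        case True
        then show ?thesis using h(2) t by simp
      next
        case False
        then have "f t = k t" using k(2) t by simp
        also have "\<dots> = h t" using goodD[OF gh(1) t] goodD[OF gh(2) t] i by simp
        finally show ?thesis .
      qed
      then show "agree H f u" using h(1) unfolding agree_def by blast
    qed
  qed
  then show ?thesis using free by blast
qed

lemma bad_generator:
  assumes S: "S \<subseteq> thompson_carrier" and H: "generate F S \<subseteq> K" and u: "u \<in> std"
    and h: "h \<in> generate F S" and bad: "\<not> good h u"
  shows "\<exists>s\<in>S \<union> m_inv F ` S. \<exists>z\<in>bad s. eqv K u z"
proof -
  let ?L = "S \<union> m_inv F ` S"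
  have L: "?L \<subseteq> thompson_carrier" using S F.inv_closed by auto
  obtain w where "h = foldr (\<otimes>\<^bsub>F\<^esub>) w \<one>\<^bsub>F\<^esub>" "set w \<subseteq> ?L"
    using h F_generate_iff[OF S] by (auto simp: word_products_def)
  then show ?thesis using bad
  proof (induction w arbitrary: h)
    case Nil
    then show ?case using good_one[OF u] by simp
  next
    case (Cons s w)
    let ?h = "foldr (\<otimes>\<^bsub>F\<^esub>) w \<one>\<^bsub>F\<^esub>"
    have s: "s \<in> ?L" "s \<in> thompson_carrier" using Cons.prems L by auto
    have "?h \<in> word_products F S (length w)" using Cons.prems by (auto simp: word_products_def)
    then have hF: "?h \<in> thompson_carrier" and hK: "?h \<in> K"
      using F_word_products_carrier[OF S] F_generate_iff[OF S] H by blast+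
    show ?case
    proof (cases "good ?h u")
      case True
      then have "\<not> good s (img ?h u)" using good_mult[OF s(2) hF u True] Cons.prems by auto
      then have "img ?h u \<in> bad s" using img_std[OF True] by (simp add: bad_def)
      then show ?thesis using s(1) True u hK unfolding eqv_def by blast
    next
      case False
      then show ?thesis using Cons by auto
    qed
  qed
qed

lemma Cl_finite_core:
  assumes H: "subgroup H F" and fg: "finitely_generated F H"
  shows "finite_core (Cl H)"
proof -
  obtain S where S: "finite S" "S \<subseteq> thompson_carrier" "generate F S = H"
    using fg by (auto simp: finitely_generated_def finite_generating_set_def)
  have HF: "H \<subseteq> thompson_carrier" using subgroup.subset[OF H] by simp
  let ?L = "S \<union> m_inv F ` S"
  let ?Z = "\<Union>s\<in>?L. bad s"
  have L: "?L \<subseteq> thompson_carrier" using S F.inv_closed by auto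
  have fin: "finite ?Z" using S(1) L finite_bad by auto
  have sub: "?Z \<subseteq> std" by (auto simp: bad_def)
  have cov: "\<exists>z\<in>?Z. eqv (Cl H) u z" if u: "u \<in> std" and k: "k \<in> Cl H" "\<not> good k u" for u k
  proof -
    have "\<exists>h\<in>H. \<not> good h u"
    proof (rule ccontr)
      assume "\<not> (\<exists>h\<in>H. \<not> good h u)"
      then have g: "\<forall>h\<in>H. good h u" by blast
      then obtain h where h: "h \<in> H" "\<And>t. t \<in> {fst u..snd u} \<Longrightarrow> k t = h t"
        using Cl_free[OF k(1) u] unfolding agree_def by blast
      then show False using good_cong(1)[of u k h, OF h(2) less_imp_le[OF std_bounds(5)[OF u]]] g k(2) by blast
    qed
    then obtain h where h: "h \<in> generate F S" "\<not> good h u" using S(3) by blast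
    have "generate F S \<subseteq> Cl H" using subset_Cl[OF HF] S(3) by simp
    from bad_generator[OF S(2) this u h] show ?thesis by blast
  qed
  interpret subgroup "Cl H" F by (rule Cl_subgroup[OF H])
  show ?thesis
  proof unfold_locales
    show "glue c f g \<in> Cl H" if "f \<in> Cl H" "g \<in> Cl H" "c \<in> dyadic" "c \<in> {0..1}" "f c = g c" for f g c
      using glue_Cl that by blast
    show "\<exists>Z. finite Z \<and> Z \<subseteq> std \<and> (\<forall>u\<in>std. (\<exists>k\<in>Cl H. \<not> good k u) \<longrightarrow> (\<exists>z\<in>Z. eqv (Cl H) u z))"
    proof (intro exI[of _ ?Z] conjI ballI impI)
      show "\<exists>z\<in>?Z. eqv (Cl H) u z" if "u \<in> std" "\<exists>k\<in>Cl H. \<not> good k u" for u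
        using cov that by metis
    qed (rule fin sub)+
  qed
qed

theorem theorem1p4:
  fixes H :: "(real \<Rightarrow> real) set"
  assumes "subgroup H thompson_F"
    and "finitely_generated thompson_F H"
  shows "finitely_generated thompson_F (Cl H) \<and> linear_distortion thompson_F (Cl H)"
proof -
  interpret C: finite_core "Cl H" by (rule Cl_finite_core[OF assms])
  have "finitely_generated F (Cl H)"
    using C.core_gens_generate unfolding finitely_generated_def by blast
  then show ?thesis
    using F_finitely_generated C.distortion_bound unfolding linear_distortion_def by blast
qed

end
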